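(* Let $N$ be an infinite supernatural number and let $\delta:\mathcal B(N)\to B(N)$ be a derivation in the Bunce-Deddens algebra $B(N)$. Then there exists a unique constant $C\in\mathbb C$ such that $$\delta(b)=C[\mathbb L,b]+\tilde\delta(b)\qquad(b\in\mathcal B(N)),$$ where $\tilde\delta:\mathcal B(N)\to B(N)$ is an approximately inner derivation.
   Context: A supernatural number is a formal product $N=\prod_{p\text{ prime}}p^{\epsilon_p}$ with $\epsilon_p\in\{0,1,\dots,\infty\}$; it is finite (an ordinary positive integer) if $\sum_p\epsilon_p<\infty$, and infinite otherwise. A positive integer $j$ divides $N$ ($j\mid N$) if for each prime $p$ the exponent of $p$ in $j$ is at most $\epsilon_p$. On $\ell^2(\mathbb Z)$ with canonical basis $\{E_l\}_{l\in\mathbb Z}$ let $VE_l=E_{l+1}$ be the bilateral shift, let $\mathbb L E_l=lE_l$, and for a sequence $b(l)$ let $b(\mathbb L)E_l=b(l)E_l$. Let $\mathcal B_{\mathrm{diag}}(N)=\{b(\mathbb L): b(l+j)=b(l)\ \forall l,\text{ for some positive integer } j\mid N\}$. The Bunce-Deddens algebra is (up to isomorphism) $B(N)=\mathrm C^*(V,\mathcal B_{\mathrm{diag}}(N))$, the C$^*$-algebra on $\ell^2(\mathbb Z)$ generated by $V$ and $\mathcal B_{\mathrm{diag}}(N)$; $\mathcal B(N)$ is the dense $^*$-subalgebra generated algebraically by $V,V^{-1}$ and $\mathcal B_{\mathrm{diag}}(N)$, i.e. the set of finite sums $\sum_n V^nb_n(\mathbb L)$ with $b_n(\mathbb L)\in\mathcal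 B_{\mathrm{diag}}(N)$. A derivation in $B(N)$ is a linear map $\delta:\mathcal B(N)\to B(N)$ with $\delta(ab)=\delta(a)b+a\,\delta(b)$ for all $a,b\in\mathcal B(N)$. It is approximately inner if there are $b_n\in B(N)$ with $\delta(b)=\lim_{n\to\infty}[b_n,b]$ (in norm) for every $b\in\mathcal B(N)$. For $b\in\mathcal B(N)$ the commutator $[\mathbb L,b]$, computed on the linear span of $\{E_l\}$, extends to a bounded operator in $B(N)$. *)

theory Defs
  imports "HOL-Analysis.Analysis" "HOL-Computational_Algebra.Computational_Algebra"
begin

section \<open>Supernatural numbers\<close>

text \<open>A supernatural number is represented by its exponents \<open>p \<mapsto> \<epsilon>\<^sub>p\<close>; only the values at
  primes are ever used.\<close>

type_synonym supernatural = "nat \<Rightarrow> enat"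

text \<open>Sums in \<^typ>\<open>enat\<close> always converge (\<open>summable_on_enat\<close>), so this is the condition
  that the sum of the exponents is not finite.\<close>

definition infinite_supernatural :: "supernatural \<Rightarrow> bool" where
  "infinite_supernatural N \<longleftrightarrow> (\<Sum>\<^sub>\<infinity>p\<in>{p. prime p}. N p) = \<infinity>"

definition dvd_supernatural :: "nat \<Rightarrow> supernatural \<Rightarrow> bool"  (infix \<open>dvd\<^sub>s\<close> 50) where
  "j dvd\<^sub>s N \<longleftrightarrow> j > 0 \<and> (\<forall>p. prime p \<longrightarrow> enat (multiplicity p j) \<le> N p)"

section \<open>Complex normed spaces\<close>

class complex_normed_space = real_normed_vector +
  fixes scaleC :: "complex \<Rightarrow> 'a \<Rightarrow> 'a"  (infixr \<open>*\<^sub>C\<close> 75)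
  assumes scaleC_add_right: "c *\<^sub>C (x + y) = c *\<^sub>C x + c *\<^sub>C y"
    and scaleC_add_left: "(c + d) *\<^sub>C x = c *\<^sub>C x + d *\<^sub>C x"
    and scaleC_scaleC: "c *\<^sub>C d *\<^sub>C x = (c * d) *\<^sub>C x"
    and scaleC_one: "1 *\<^sub>C x = x"
    and scaleC_of_real: "complex_of_real r *\<^sub>C x = r *\<^sub>R x"
    and norm_scaleC: "norm (c *\<^sub>C x) = cmod c * norm x"

global_interpretation complex_space: vector_space "scaleC :: complex \<Rightarrow> 'a \<Rightarrow> 'a::complex_normed_space"
  by unfold_locales (simp_all add: scaleC_add_right scaleC_add_left scaleC_scaleC scaleC_one)

lemma bounded_linear_scaleC: "bounded_linear (\<lambda>x::'a::complex_normed_space. c *\<^sub>C x)"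
proof (rule bounded_linear_intro[where K = "cmod c"])
  show "c *\<^sub>C (r *\<^sub>R x) = r *\<^sub>R (c *\<^sub>C x)" for r and x :: 'a
    by (simp add: scaleC_of_real[symmetric] scaleC_scaleC mult.commute)
qed (simp_all add: scaleC_add_right norm_scaleC mult.commute)

instantiation blinfun :: (real_normed_vector, complex_normed_space) complex_normed_space
begin

lift_definition scaleC_blinfun :: "complex \<Rightarrow> 'a \<Rightarrow>\<^sub>L 'b \<Rightarrow> 'a \<Rightarrow>\<^sub>L 'b"
  is "\<lambda>c A x. c *\<^sub>C A x"
  by (rule bounded_linear_compose[OF bounded_linear_scaleC])

instance
proof
  fix c d :: complex and r :: real and A B :: "'a \<Rightarrow>\<^sub>L 'b"
  show "c *\<^sub>C (A + B) = c *\<^sub>C A + c *\<^sub>C B"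
    by transfer (simp add: scaleC_add_right)
  show "(c + d) *\<^sub>C A = c *\<^sub>C A + d *\<^sub>C A"
    by transfer (simp add: scaleC_add_left)
  show "c *\<^sub>C d *\<^sub>C A = (c * d) *\<^sub>C A"
    by transfer (simp add: scaleC_scaleC)
  show "1 *\<^sub>C A = A"
    by transfer (simp add: scaleC_one)
  show "complex_of_real r *\<^sub>C A = r *\<^sub>R A"
    by transfer (simp add: scaleC_of_real)
  have le: "norm (c *\<^sub>C A) \<le> cmod c * norm A" for c and A :: "'a \<Rightarrow>\<^sub>L 'b"
    by (rule norm_blinfun_bound)
       (auto simp: scaleC_blinfun.rep_eq norm_scaleC mult.assoc intro!: mult_left_mono norm_blinfun)
  show "norm (c *\<^sub>C A) = cmod c * norm A"
  proof (cases "c = 0")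
    case True
    then show ?thesis using le[of 0 A] by simp
  next
    case False
    have "inverse c *\<^sub>C c *\<^sub>C A = A"
      using False by transfer (simp add: scaleC_scaleC scaleC_one)
    then have "norm A \<le> cmod (inverse c) * norm (c *\<^sub>C A)"
      using le[of "inverse c" "c *\<^sub>C A"] by simp
    then have "cmod c * norm A \<le> cmod c * (cmod (inverse c) * norm (c *\<^sub>C A))"
      by (intro mult_left_mono) simp_all
    also have "\<dots> = norm (c *\<^sub>C A)"
      using False by (simp add: norm_inverse)
    finally show ?thesis using le[of c A] by simp
  qed
qed

end

section \<open>The Hilbert space of square-summable bilateral sequences\<close>

typedef ell2 = "{x :: int \<Rightarrow> complex. (\<lambda>l. (cmod (x l))\<^sup>2) summable_on UNIV}"
  morphisms coord Abs_ell2
  by (rule exI[of _ "\<lambda>_. 0"]) simp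

setup_lifting type_definition_ell2

lemma coord_summable: "(\<lambda>l. (cmod (coord x l))\<^sup>2) summable_on UNIV"
  using coord[of x] by simp

lemma ell2_eqI: "(\<And>l. coord x l = coord y l) \<Longrightarrow> x = y"
  by (simp add: coord_inject[symmetric] fun_eq_iff)

lemma square_summable_add:
  fixes x y :: "int \<Rightarrow> complex"
  assumes "(\<lambda>l. (cmod (x l))\<^sup>2) summable_on UNIV" "(\<lambda>l. (cmod (y l))\<^sup>2) summable_on UNIV"
  shows "(\<lambda>l. (cmod (x l + y l))\<^sup>2) summable_on UNIV"
proof (rule summable_on_comparison_test)
  show "(\<lambda>l. 2 * (cmod (x l))\<^sup>2 + 2 * (cmod (y l))\<^sup>2) summable_on UNIV"
    using assms by (intro summable_on_add summable_on_cmult_right)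
  show "(cmod (x l + y l))\<^sup>2 \<le> 2 * (cmod (x l))\<^sup>2 + 2 * (cmod (y l))\<^sup>2" for l
  proof -
    have "(cmod (x l + y l))\<^sup>2 \<le> (cmod (x l) + cmod (y l))\<^sup>2"
      by (intro power_mono norm_triangle_ineq) simp
    also have "\<dots> \<le> 2 * (cmod (x l))\<^sup>2 + 2 * (cmod (y l))\<^sup>2"
      using zero_le_power2[of "cmod (x l) - cmod (y l)"] by (simp add: power2_eq_square algebra_simps)
    finally show ?thesis .
  qed
qed simp

lemma square_summable_mult:
  fixes x b :: "int \<Rightarrow> complex"
  assumes "(\<lambda>l. (cmod (x l))\<^sup>2) summable_on UNIV" "\<And>l. cmod (b l) \<le> K"
  shows "(\<lambda>l. (cmod (b l * x l))\<^sup>2) summable_on UNIV"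
proof (rule summable_on_comparison_test)
  show "(\<lambda>l. K\<^sup>2 * (cmod (x l))\<^sup>2) summable_on UNIV"
    using assms(1) by (intro summable_on_cmult_right)
  show "(cmod (b l * x l))\<^sup>2 \<le> K\<^sup>2 * (cmod (x l))\<^sup>2" for l
    using assms(2)[of l] by (simp add: norm_mult power_mult_distrib mult_right_mono power_mono)
qed simp

lemma inner_summable: "(\<lambda>l. coord x l \<bullet> coord y l) summable_on UNIV"
proof -
  have "(\<lambda>l. 1 / 2 * (cmod (coord x l + coord y l))\<^sup>2
      + (- 1 / 2 * (cmod (coord x l))\<^sup>2 + - 1 / 2 * (cmod (coord y l))\<^sup>2)) summable_on UNIV"
    by (intro summable_on_add summable_on_cmult_right square_summable_add coord_summable)
  moreover have "1 / 2 * (cmod (a + b))\<^sup>2 + (- 1 / 2 * (cmod a)\<^sup>2 + - 1 / 2 * (cmod b)\<^sup>2) = a \<bullet> b"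
    for a b :: complex
    by (simp add: power2_norm_eq_inner inner_add_left inner_add_right inner_commute field_simps)
  ultimately show ?thesis by (simp only:)
qed

instantiation ell2 :: real_vector
begin

lift_definition zero_ell2 :: ell2 is "\<lambda>_. 0" by simp
lift_definition plus_ell2 :: "ell2 \<Rightarrow> ell2 \<Rightarrow> ell2" is "\<lambda>x y l. x l + y l"
  by (rule square_summable_add)
lift_definition uminus_ell2 :: "ell2 \<Rightarrow> ell2" is "\<lambda>x l. - x l" by simp
lift_definition minus_ell2 :: "ell2 \<Rightarrow> ell2 \<Rightarrow> ell2" is "\<lambda>x y l. x l - y l"
  using square_summable_add[where y = "\<lambda>l. - y l" for y] by simp
lift_definition scaleR_ell2 :: "real \<Rightarrow> ell2 \<Rightarrow> ell2" is "\<lambda>r x l. complex_of_real r * x l"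
  by (rule square_summable_mult) auto

instance
proof
  fix x y z :: ell2 and r s :: real
  show "x + y + z = x + (y + z)" "x + y = y + x" "0 + x = x" "- x + x = 0" "x - y = x + - y"
    by (transfer; simp add: algebra_simps)+
  show "r *\<^sub>R (x + y) = r *\<^sub>R x + r *\<^sub>R y" "(r + s) *\<^sub>R x = r *\<^sub>R x + s *\<^sub>R x"
    "r *\<^sub>R s *\<^sub>R x = (r * s) *\<^sub>R x" "1 *\<^sub>R x = x"
    by (transfer; simp add: algebra_simps)+
qed

end

instantiation ell2 :: real_inner
begin

definition inner_ell2 :: "ell2 \<Rightarrow> ell2 \<Rightarrow> real" where
  "inner_ell2 x y = (\<Sum>\<^sub>\<infinity>l. coord x l \<bullet> coord y l)"
definition norm_ell2 :: "ell2 \<Rightarrow> real" where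
  "norm_ell2 x = sqrt (\<Sum>\<^sub>\<infinity>l. (cmod (coord x l))\<^sup>2)"
definition sgn_ell2 :: "ell2 \<Rightarrow> ell2" where
  "sgn_ell2 x = x /\<^sub>R norm x"
definition dist_ell2 :: "ell2 \<Rightarrow> ell2 \<Rightarrow> real" where
  "dist_ell2 x y = norm (x - y)"
definition uniformity_ell2 :: "(ell2 \<times> ell2) filter" where
  "uniformity_ell2 = (INF e\<in>{0<..}. principal {(x, y). dist x y < e})"
definition open_ell2 :: "ell2 set \<Rightarrow> bool" where
  "open_ell2 U \<longleftrightarrow> (\<forall>x\<in>U. \<forall>\<^sub>F (x', y) in uniformity. x' = x \<longrightarrow> y \<in> U)"

instance
proof
  fix x y z :: ell2 and r :: real
  show "sgn x = x /\<^sub>R norm x" by (rule sgn_ell2_def)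
  show "dist x y = norm (x - y)" by (rule dist_ell2_def)
  show "(uniformity :: (ell2 \<times> ell2) filter) = (INF e\<in>{0<..}. principal {(x, y). dist x y < e})"
    by (rule uniformity_ell2_def)
  show "open U \<longleftrightarrow> (\<forall>x\<in>U. \<forall>\<^sub>F (x', y) in uniformity. x' = x \<longrightarrow> y \<in> U)" for U :: "ell2 set"
    by (rule open_ell2_def)
  show "x \<bullet> y = y \<bullet> x" by (simp add: inner_ell2_def inner_commute)
  show "(x + y) \<bullet> z = x \<bullet> z + y \<bullet> z"
    by (simp add: inner_ell2_def plus_ell2.rep_eq inner_add_left infsum_add inner_summable)
  show "(r *\<^sub>R x) \<bullet> y = r * (x \<bullet> y)"
    unfolding inner_ell2_def scaleR_ell2.rep_eq scaleR_conv_of_real[symmetric] inner_scaleR_left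
    by (rule infsum_cmult_right) (auto simp: inner_summable)
  show "0 \<le> x \<bullet> x" by (simp add: inner_ell2_def infsum_nonneg)
  show "x \<bullet> x = 0 \<longleftrightarrow> x = 0"
  proof
    assume "x \<bullet> x = 0"
    then have "coord x l \<bullet> coord x l = 0" for l
      by (intro nonneg_infsum_le_0D[OF _ inner_summable]) (auto simp: inner_ell2_def)
    then show "x = 0" by (intro ell2_eqI) (simp add: zero_ell2.rep_eq)
  qed (simp add: inner_ell2_def zero_ell2.rep_eq)
  show "norm x = sqrt (x \<bullet> x)"
    by (simp add: norm_ell2_def inner_ell2_def power2_norm_eq_inner)
qed

end

instantiation ell2 :: complex_normed_space
begin

lift_definition scaleC_ell2 :: "complex \<Rightarrow> ell2 \<Rightarrow> ell2" is "\<lambda>c x l. c * x l"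
  by (rule square_summable_mult) auto

instance
proof
  fix c d :: complex and r :: real and x y :: ell2
  show "c *\<^sub>C (x + y) = c *\<^sub>C x + c *\<^sub>C y" "(c + d) *\<^sub>C x = c *\<^sub>C x + d *\<^sub>C x"
    "c *\<^sub>C d *\<^sub>C x = (c * d) *\<^sub>C x" "1 *\<^sub>C x = x" "complex_of_real r *\<^sub>C x = r *\<^sub>R x"
    by (transfer; simp add: algebra_simps)+
  have "(\<Sum>\<^sub>\<infinity>l. (cmod c)\<^sup>2 * (cmod (coord x l))\<^sup>2) = (cmod c)\<^sup>2 * (\<Sum>\<^sub>\<infinity>l. (cmod (coord x l))\<^sup>2)"
    by (rule infsum_cmult_right) (auto simp: coord_summable)
  then show "norm (c *\<^sub>C x) = cmod c * norm x"
    by (simp add: norm_ell2_def scaleC_ell2.rep_eq norm_mult power_mult_distrib real_sqrt_mult)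
qed

end

definition cinner :: "ell2 \<Rightarrow> ell2 \<Rightarrow> complex" where
  "cinner x y = (\<Sum>\<^sub>\<infinity>l. coord x l * cnj (coord y l))"

lift_definition E :: "int \<Rightarrow> ell2" is "\<lambda>k l. if l = k then 1 else 0"
proof -
  fix k :: int
  have "(\<lambda>l. (cmod (if l = k then 1 else 0))\<^sup>2) summable_on {k}"
    by (rule summable_on_finite) simp
  then show "(\<lambda>l. (cmod (if l = k then 1 else 0))\<^sup>2) summable_on UNIV"
    by (rule summable_on_cong_neutral[THEN iffD1, rotated -1]) auto
qed

section \<open>Operators\<close>

text \<open>Elements of \<open>ell2 \<Rightarrow>\<^sub>L ell2\<close> are only real-linear, so the bounded operators on
  the complex Hilbert space are singled out by complex linearity. The topology is that of the operator norm.\<close>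

type_synonym operator = "ell2 \<Rightarrow>\<^sub>L ell2"

definition bounded_ops :: "operator set" where
  "bounded_ops = {A. Vector_Spaces.linear scaleC scaleC (blinfun_apply A)}"

definition is_adjoint :: "operator \<Rightarrow> operator \<Rightarrow> bool" where
  "is_adjoint A A' \<longleftrightarrow> (\<forall>x y. cinner (A x) y = cinner x (A' y))"

definition star_subalgebra :: "operator set \<Rightarrow> bool" where
  "star_subalgebra S \<longleftrightarrow> S \<subseteq> bounded_ops \<and> complex_space.subspace S \<and>
     (\<forall>A\<in>S. \<forall>B\<in>S. A o\<^sub>L B \<in> S) \<and> (\<forall>A\<in>S. \<forall>A'. is_adjoint A A' \<longrightarrow> A' \<in> S)"

definition commutator :: "operator \<Rightarrow> operator \<Rightarrow> operator" where
  "commutator A B = (A o\<^sub>L B) - (B o\<^sub>L A)"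

lemma square_summable_shift:
  fixes x :: "int \<Rightarrow> complex"
  assumes "(\<lambda>l. (cmod (x l))\<^sup>2) summable_on UNIV"
  shows "(\<lambda>l. (cmod (x (l - k)))\<^sup>2) summable_on UNIV"
proof -
  have "bij_betw (\<lambda>l. l - k) UNIV UNIV"
    by (rule bij_betw_byWitness[where f' = "\<lambda>l. l + k"]) auto
  from summable_on_reindex_bij_betw[OF this, of "\<lambda>l. (cmod (x l))\<^sup>2"] assms show ?thesis by simp
qed

lift_definition shift_ell2 :: "int \<Rightarrow> ell2 \<Rightarrow> ell2" is "\<lambda>k x l. x (l - k)"
  by (rule square_summable_shift)

lemma norm_shift_ell2: "norm (shift_ell2 k x) = norm x"
proof -
  have "bij_betw (\<lambda>l. l - k) UNIV UNIV"
    by (rule bij_betw_byWitness[where f' = "\<lambda>l. l + k"]) auto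
  from infsum_reindex_bij_betw[OF this, of "\<lambda>l. (cmod (coord x l))\<^sup>2"] show ?thesis
    by (simp add: norm_ell2_def shift_ell2.rep_eq)
qed

lift_definition shift :: "int \<Rightarrow> operator" is shift_ell2
  by (rule bounded_linear_intro[where K = 1])
     (auto intro!: ell2_eqI simp: shift_ell2.rep_eq plus_ell2.rep_eq scaleR_ell2.rep_eq norm_shift_ell2)

abbreviation V :: operator where "V \<equiv> shift 1"
abbreviation V_inv :: operator where "V_inv \<equiv> shift (- 1)"

lemma V_E: "V (E l) = E (l + 1)"
  by (rule ell2_eqI) (auto simp: shift.rep_eq shift_ell2.rep_eq E.rep_eq)

lemma V_V_inv: "V o\<^sub>L V_inv = id_blinfun" "V_inv o\<^sub>L V = id_blinfun"
  by (auto intro!: blinfun_eqI ell2_eqI simp: shift.rep_eq shift_ell2.rep_eq)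

text \<open>Coordinatewise multiplication by \<open>b\<close>; meaningful at those \<open>x\<close> for which the product is
  square-summable.\<close>

definition mult_ell2 :: "(int \<Rightarrow> complex) \<Rightarrow> ell2 \<Rightarrow> ell2" where
  "mult_ell2 b x = Abs_ell2 (\<lambda>l. b l * coord x l)"

text \<open>The operator \<open>b(\<bbbL>)\<close>; meaningful for bounded \<open>b\<close>.\<close>

definition diag_op :: "(int \<Rightarrow> complex) \<Rightarrow> operator" where
  "diag_op b = Blinfun (mult_ell2 b)"

lemma diag_op_coord:
  assumes "\<And>l. cmod (b l) \<le> K"
  shows "coord (diag_op b x) l = b l * coord x l"
proof -
  have coord_mult: "coord (mult_ell2 b x) l = b l * coord x l" for x l
    using square_summable_mult[OF coord_summable assms] by (simp add: mult_ell2_def Abs_ell2_inverse)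
  have K: "0 \<le> K" using assms[of 0] norm_ge_zero[of "b 0"] by linarith
  have "norm (mult_ell2 b x) \<le> norm x * K" for x
  proof -
    have "(\<Sum>\<^sub>\<infinity>l. (cmod (b l * coord x l))\<^sup>2) \<le> (\<Sum>\<^sub>\<infinity>l. K\<^sup>2 * (cmod (coord x l))\<^sup>2)"
      using assms
      by (intro infsum_mono square_summable_mult[OF coord_summable assms] summable_on_cmult_right coord_summable)
         (auto simp: norm_mult power_mult_distrib intro!: mult_right_mono power_mono)
    also have "\<dots> = K\<^sup>2 * (\<Sum>\<^sub>\<infinity>l. (cmod (coord x l))\<^sup>2)"
      by (rule infsum_cmult_right) (auto simp: coord_summable)
    finally have "norm (mult_ell2 b x) \<le> sqrt (K\<^sup>2 * (\<Sum>\<^sub>\<infinity>l. (cmod (coord x l))\<^sup>2))"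
      by (simp add: norm_ell2_def coord_mult)
    then show ?thesis using K by (simp add: norm_ell2_def real_sqrt_mult mult.commute)
  qed
  then have "bounded_linear (mult_ell2 b)"
    by (intro bounded_linear_intro[where K = K])
       (auto intro!: ell2_eqI simp: coord_mult plus_ell2.rep_eq scaleR_ell2.rep_eq algebra_simps)
  then show ?thesis by (simp add: diag_op_def bounded_linear_Blinfun_apply coord_mult)
qed

lemma diag_op_E: "(\<And>l. cmod (b l) \<le> K) \<Longrightarrow> diag_op b (E l) = b l *\<^sub>C E l"
  by (rule ell2_eqI) (simp add: diag_op_coord[of b K] scaleC_ell2.rep_eq E.rep_eq)

text \<open>\<open>\<bbbL>\<close> is unbounded; it is only applied on the complex linear span of the canonical basis.\<close>

definition number_op :: "ell2 \<Rightarrow> ell2" where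
  "number_op = mult_ell2 of_int"

lemma number_op_E: "number_op (E l) = of_int l *\<^sub>C E l"
proof -
  have "(\<lambda>k. of_int k * coord (E l) k) = coord (of_int l *\<^sub>C E l)"
    by (auto simp: E.rep_eq scaleC_ell2.rep_eq)
  then show ?thesis by (simp add: number_op_def mult_ell2_def coord_inverse)
qed

text \<open>The bounded extension of \<open>[\<bbbL>, b]\<close>. It is unique if it exists, by density of the span, and it
  exists for the elements \<open>b\<close> of \<open>alg_BD N\<close> below, which also leave the span invariant.\<close>

definition L_commutator :: "operator \<Rightarrow> operator" where
  "L_commutator b = (THE D. D \<in> bounded_ops \<and>
     (\<forall>x\<in>complex_space.span (range E). D x = number_op (b x) - b (number_op x)))"

section \<open>Bunce-Deddens algebras\<close>

definition diag_BD :: "supernatural \<Rightarrow> operator set" where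
  "diag_BD N = {diag_op b | b. \<exists>j. j dvd\<^sub>s N \<and> (\<forall>l. b (l + int j) = b l)}"

definition alg_BD :: "supernatural \<Rightarrow> operator set" where
  "alg_BD N = star_subalgebra hull ({V, V_inv} \<union> diag_BD N)"

definition BD :: "supernatural \<Rightarrow> operator set" where
  "BD N = (\<lambda>S. star_subalgebra S \<and> closed S) hull ({V} \<union> diag_BD N)"

text \<open>Maps on \<open>alg_BD N\<close> are represented by functions on all operators, whose values
  outside \<open>alg_BD N\<close> are irrelevant.\<close>

definition derivation :: "supernatural \<Rightarrow> (operator \<Rightarrow> operator) \<Rightarrow> bool" where
  "derivation N \<delta> \<longleftrightarrow>
     (\<forall>a\<in>alg_BD N. \<delta> a \<in> BD N) \<and>
     (\<forall>a\<in>alg_BD N. \<forall>b\<in>alg_BD N. \<delta> (a + b) = \<delta> a + \<delta> b) \<and>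
     (\<forall>c. \<forall>a\<in>alg_BD N. \<delta> (c *\<^sub>C a) = c *\<^sub>C \<delta> a) \<and>
     (\<forall>a\<in>alg_BD N. \<forall>b\<in>alg_BD N. \<delta> (a o\<^sub>L b) = (\<delta> a o\<^sub>L b) + (a o\<^sub>L \<delta> b))"

definition approximately_inner :: "supernatural \<Rightarrow> (operator \<Rightarrow> operator) \<Rightarrow> bool" where
  "approximately_inner N \<delta> \<longleftrightarrow>
     (\<exists>b :: nat \<Rightarrow> operator. (\<forall>n. b n \<in> BD N) \<and>
        (\<forall>a\<in>alg_BD N. (\<lambda>n. commutator (b n) a) \<longlonglongrightarrow> \<delta> a))"

end

theory Submission
  imports Defs
begin

text \<open>
  Write \<open>\<alpha>(T) = V T V\<^sup>-\<^sup>1\<close>. The \<open>j\<close>-periodic diagonal operators form a finite-dimensional algebra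
  spanned by orthogonal projections \<open>P\<^sub>k\<close>, on which \<open>\<delta>\<close> agrees with the commutator with
  \<open>c\<^sub>j = \<Sum>\<^sub>k \<delta>(P\<^sub>k) P\<^sub>k\<close>. What is left of \<open>\<delta>(V)\<close> is \<open>T\<^sub>j V\<close>, where
  \<open>T\<^sub>j = \<delta>(V) V\<^sup>-\<^sup>1 - (c\<^sub>j - \<alpha>(c\<^sub>j))\<close> commutes with these operators. The averages
  \<open>(T + \<alpha>(T) + \<dots> + \<alpha>\<^sup>M\<^sup>-\<^sup>1(T)) / M\<close>, with \<open>M\<close> running through a divisibility chain of divisors
  of \<open>N\<close>, converge in norm and kill coboundaries \<open>x - \<alpha>(x)\<close>, so the limit for \<open>T\<^sub>j\<close> does not depend on \<open>j\<close>; it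
  commutes with \<open>V\<close> and with all periodic diagonal operators, hence is a scalar \<open>C\<close> as \<open>N\<close> is
  infinite. Since the difference of \<open>T\<^sub>j\<close> and its averages is a coboundary of an element commuting with
  the \<open>j\<close>-periodic diagonal operators, adding that element to \<open>c\<^sub>j\<close> gives commutators converging to
  \<open>\<delta> - C [\<bbbL>, \<cdot>]\<close> on the generators. Conversely, if \<open>[b\<^sub>n, V] \<rightarrow> C V\<close>, then
  \<open>b\<^sub>n - \<alpha>(b\<^sub>n) \<rightarrow> C\<close>, and averaging gives \<open>C = 0\<close>.
\<close>

section \<open>The Hilbert space and adjoints\<close>

interpretation op_comp: bounded_bilinear "(o\<^sub>L) :: operator \<Rightarrow> operator \<Rightarrow> operator"
  by (rule bounded_bilinear_blinfun_compose)

lemmas coord_simps = zero_ell2.rep_eq plus_ell2.rep_eq uminus_ell2.rep_eq minus_ell2.rep_eq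
  scaleR_ell2.rep_eq scaleC_ell2.rep_eq E.rep_eq

lemma coord_shift [simp]: "coord (shift k x) l = coord x (l - k)"
  by (simp add: shift.rep_eq shift_ell2.rep_eq)

lemma coord_sum: "coord (sum f A) l = (\<Sum>a\<in>A. coord (f a) l)"
  by (induction A rule: infinite_finite_induct) (simp_all add: coord_simps)

lemma norm_ell2_power2: "(norm x)\<^sup>2 = (\<Sum>\<^sub>\<infinity>l. (cmod (coord x l))\<^sup>2)"
  by (simp add: norm_ell2_def infsum_nonneg)

lemma sum_coord_le: "finite F \<Longrightarrow> (\<Sum>l\<in>F. (cmod (coord x l))\<^sup>2) \<le> (norm x)\<^sup>2"
  unfolding norm_ell2_power2 by (intro finite_sum_le_infsum coord_summable) auto

lemma cmod_coord_le: "cmod (coord x l) \<le> norm x"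
  using sum_coord_le[of "{l}" x] by (simp add: power2_le_iff_abs_le)

text \<open>Fatou's lemma for sums: each finite partial sum passes to the limit, and finite partial
  sums control the whole sum. Completeness below takes from it both the membership of the limit in
  \<open>ell2\<close> and the error estimate.\<close>

lemma ell2_bounded_limit:
  fixes X :: "nat \<Rightarrow> ell2" and y :: "int \<Rightarrow> complex"
  assumes lim: "\<And>l. (\<lambda>n. coord (X n) l) \<longlonglongrightarrow> y l"
    and bound: "\<forall>\<^sub>F n in sequentially. norm (X n) \<le> K" and "0 \<le> K"
  shows "(\<lambda>l. (cmod (y l))\<^sup>2) summable_on UNIV" "(\<Sum>\<^sub>\<infinity>l. (cmod (y l))\<^sup>2) \<le> K\<^sup>2"
proof -
  have le: "(\<Sum>l\<in>F. (cmod (y l))\<^sup>2) \<le> K\<^sup>2" if "finite F" for F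
  proof (rule tendsto_upperbound)
    show "(\<lambda>n. \<Sum>l\<in>F. (cmod (coord (X n) l))\<^sup>2) \<longlonglongrightarrow> (\<Sum>l\<in>F. (cmod (y l))\<^sup>2)"
      by (intro tendsto_intros lim)
    show "\<forall>\<^sub>F n in sequentially. (\<Sum>l\<in>F. (cmod (coord (X n) l))\<^sup>2) \<le> K\<^sup>2"
      using bound by eventually_elim (rule order_trans[OF sum_coord_le[OF that] power_mono], simp_all)
  qed simp
  then show *: "(\<lambda>l. (cmod (y l))\<^sup>2) summable_on UNIV"
    by (intro nonneg_bdd_above_summable_on bdd_aboveI2) auto
  show "(\<Sum>\<^sub>\<infinity>l. (cmod (y l))\<^sup>2) \<le> K\<^sup>2"
    using le by (intro infsum_le_finite_sums *) auto
qed

text \<open>Completeness is inherited by the type \<open>operator\<close>, where limits of averages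
  are later obtained from the Cauchy property.\<close>

instance ell2 :: banach
proof
  fix X :: "nat \<Rightarrow> ell2"
  assume X: "Cauchy X"
  have "Cauchy (\<lambda>n. coord (X n) l)" for l
  proof (rule CauchyI)
    fix e :: real assume "0 < e"
    then obtain M where "\<forall>m\<ge>M. \<forall>n\<ge>M. norm (X m - X n) < e" using CauchyD[OF X] by blast
    moreover have "norm (coord (X m) l - coord (X n) l) \<le> norm (X m - X n)" for m n
      using cmod_coord_le[of "X m - X n" l] by (simp add: coord_simps)
    ultimately show "\<exists>M. \<forall>m\<ge>M. \<forall>n\<ge>M. norm (coord (X m) l - coord (X n) l) < e"
      by (meson le_less_trans)
  qed
  then have "convergent (\<lambda>n. coord (X n) l)" for l by (simp add: Cauchy_convergent)
  then obtain y where y: "\<And>l. (\<lambda>n. coord (X n) l) \<longlonglongrightarrow> y l"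
    unfolding convergent_def by metis
  obtain K where K: "\<And>n. norm (X n) \<le> K" "0 < K"
    using Cauchy_Bseq[OF X] by (auto simp: Bseq_def)
  define x where "x = Abs_ell2 y"
  have x: "coord x = y"
    using ell2_bounded_limit(1)[OF y, of K] K by (simp add: x_def Abs_ell2_inverse)
  have "X \<longlonglongrightarrow> x"
  proof (rule LIMSEQ_I)
    fix e :: real assume "0 < e"
    \<comment> \<open>Letting \<open>m\<close> tend to infinity turns the strict bound into a weak
      one; aiming at \<open>e / 2\<close> keeps the final inequality strict.\<close>
    then obtain M where M: "\<And>m n. m \<ge> M \<Longrightarrow> n \<ge> M \<Longrightarrow> norm (X m - X n) < e / 2"
      using CauchyD[OF X, of "e / 2"] by auto
    have "norm (X n - x) < e" if "n \<ge> M" for n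
    proof -
      have "(\<Sum>\<^sub>\<infinity>l. (cmod (coord (X n) l - y l))\<^sup>2) \<le> (e / 2)\<^sup>2"
      proof (rule ell2_bounded_limit(2))
        show "(\<lambda>m. coord (X n - X m) l) \<longlonglongrightarrow> coord (X n) l - y l" for l
          unfolding coord_simps by (intro tendsto_intros y)
        show "\<forall>\<^sub>F m in sequentially. norm (X n - X m) \<le> e / 2"
          using M[OF that] by (auto simp: eventually_sequentially intro!: exI[of _ M] less_imp_le)
      qed (use \<open>0 < e\<close> in simp)
      then have "(norm (X n - x))\<^sup>2 \<le> (e / 2)\<^sup>2"
        by (simp add: norm_ell2_power2 coord_simps x)
      then have "norm (X n - x) \<le> e / 2" using \<open>0 < e\<close> by (simp add: power2_le_iff_abs_le)
      then show ?thesis using \<open>0 < e\<close> by linarith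
    qed
    then show "\<exists>M. \<forall>n\<ge>M. norm (X n - x) < e" by blast
  qed
  then show "convergent X" by (auto simp: convergent_def)
qed

text \<open>By Pythagoras, the squared error of a finite partial sum is the squared norm minus the
  finite sum of squared coefficients.\<close>

lemma ell2_basis_expansion: "((\<lambda>l. coord x l *\<^sub>C E l) has_sum x) UNIV"
proof -
  have "((\<lambda>F. (norm x)\<^sup>2 - (\<Sum>l\<in>F. (cmod (coord x l))\<^sup>2)) \<longlongrightarrow> (norm x)\<^sup>2 - (norm x)\<^sup>2)
      (finite_subsets_at_top UNIV)"
    using has_sum_infsum[OF coord_summable[of x]]
    unfolding has_sum_def norm_ell2_power2 by (intro tendsto_intros)
  then have "((\<lambda>F. (norm x)\<^sup>2 - (\<Sum>l\<in>F. (cmod (coord x l))\<^sup>2)) \<longlongrightarrow> 0)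
      (finite_subsets_at_top UNIV)" by simp
  moreover have "\<forall>\<^sub>F F in finite_subsets_at_top UNIV.
      (norm x)\<^sup>2 - (\<Sum>l\<in>F. (cmod (coord x l))\<^sup>2) = (norm ((\<Sum>l\<in>F. coord x l *\<^sub>C E l) - x))\<^sup>2"
  proof (rule eventually_finite_subsets_at_top_weakI)
    fix F :: "int set" assume F: "finite F"
    have "coord ((\<Sum>l\<in>F. coord x l *\<^sub>C E l) - x) k = (if k \<in> F then 0 else - coord x k)" for k
    proof -
      have "(\<Sum>l\<in>F. coord x l * (if k = l then 1 else 0)) = (if k \<in> F then coord x k else 0)"
        using F by (simp add: if_distrib sum.delta cong: if_cong)
      then show ?thesis by (simp add: coord_simps coord_sum)
    qed
    then have "(norm ((\<Sum>l\<in>F. coord x l *\<^sub>C E l) - x))\<^sup>2 = (\<Sum>\<^sub>\<infinity>k\<in>UNIV - F. (cmod (coord x k))\<^sup>2)"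
      unfolding norm_ell2_power2 by (intro infsum_cong_neutral) auto
    also have "\<dots> = (norm x)\<^sup>2 - (\<Sum>l\<in>F. (cmod (coord x l))\<^sup>2)"
      unfolding norm_ell2_power2 using F by (subst infsum_Diff) (auto simp: coord_summable)
    finally show "(norm x)\<^sup>2 - (\<Sum>l\<in>F. (cmod (coord x l))\<^sup>2)
        = (norm ((\<Sum>l\<in>F. coord x l *\<^sub>C E l) - x))\<^sup>2" by simp
  qed
  ultimately have "((\<lambda>F. (norm ((\<Sum>l\<in>F. coord x l *\<^sub>C E l) - x))\<^sup>2) \<longlongrightarrow> 0)
      (finite_subsets_at_top UNIV)"
    by (rule Lim_transform_eventually)
  then have "((\<lambda>F. sqrt ((norm ((\<Sum>l\<in>F. coord x l *\<^sub>C E l) - x))\<^sup>2)) \<longlongrightarrow> sqrt 0)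
      (finite_subsets_at_top UNIV)"
    by (rule tendsto_real_sqrt)
  then show ?thesis
    unfolding has_sum_def by (subst Lim_null, subst tendsto_norm_zero_iff[symmetric]) simp
qed

section \<open>Complex-linear operators\<close>

lemma bounded_ops_iff:
  "A \<in> bounded_ops \<longleftrightarrow> (\<forall>c x. A (c *\<^sub>C x) = c *\<^sub>C A x)"
  unfolding bounded_ops_def Vector_Spaces.linear_def module_hom_def module_hom_axioms_def
  by (auto simp: blinfun.add_right complex_space.module_axioms
      complex_space.vector_space_axioms)

text \<open>Continuity reduces the claim to multiples of basis vectors, and complex linearity pulls
  the coefficients out. Real-linear operators are not determined by their values on the
  basis.\<close>

lemma bounded_ops_eqI:
  assumes "A \<in> bounded_ops" "B \<in> bounded_ops" "\<And>l. A (E l) = B (E l)"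
  shows "A = B"
proof (rule blinfun_eqI)
  fix x
  have "((\<lambda>l. D (coord x l *\<^sub>C E l)) has_sum D x) UNIV" for D :: operator
    by (rule has_sum_bounded_linear[OF blinfun.bounded_linear_right ell2_basis_expansion, unfolded o_def])
  from this[of A] this[of B] show "A x = B x"
    using assms by (simp add: bounded_ops_iff has_sum_unique)
qed

section \<open>The complex inner product and adjoints\<close>

lemma cinner_E: "cinner x (E l) = coord x l"
proof -
  have "cinner x (E l) = (\<Sum>\<^sub>\<infinity>k\<in>{l}. coord x k * cnj (coord (E l) k))"
    unfolding cinner_def by (intro infsum_cong_neutral) (auto simp: coord_simps)
  then show ?thesis by (simp add: coord_simps)
qed

lemma cinner_summable: "(\<lambda>l. coord x l * cnj (coord y l)) summable_on UNIV"
proof (rule abs_summable_summable, rule summable_on_comparison_test)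
  show "(\<lambda>l. (cmod (coord x l))\<^sup>2 + (cmod (coord y l))\<^sup>2) summable_on UNIV"
    by (intro summable_on_add coord_summable)
  show "cmod (coord x l * cnj (coord y l)) \<le> (cmod (coord x l))\<^sup>2 + (cmod (coord y l))\<^sup>2" for l
  proof -
    have "2 * (cmod (coord x l) * cmod (coord y l)) \<le> (cmod (coord x l))\<^sup>2 + (cmod (coord y l))\<^sup>2"
      using sum_squares_bound[of "cmod (coord x l)" "cmod (coord y l)"] by (simp only: mult.assoc)
    moreover have "0 \<le> cmod (coord x l) * cmod (coord y l)" by simp
    ultimately show ?thesis unfolding norm_mult complex_mod_cnj by linarith
  qed
qed simp

lemma Re_cinner: "Re (cinner x y) = x \<bullet> y"
proof -
  have "((\<lambda>l. Re (coord x l * cnj (coord y l))) has_sum Re (cinner x y)) UNIV"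
    unfolding cinner_def
    by (rule has_sum_bounded_linear[OF bounded_linear_Re has_sum_infsum[OF cinner_summable], unfolded o_def])
  then show ?thesis by (simp add: inner_ell2_def inner_complex_def infsumI)
qed

lemma cinner_cnj: "cnj (cinner x y) = cinner y x"
proof -
  have "(\<Sum>\<^sub>\<infinity>l. cnj (coord x l * cnj (coord y l))) = cnj (cinner x y)"
    unfolding cinner_def by (simp add: infsum_cnj del: complex_cnj_mult)
  then show ?thesis by (simp add: cinner_def mult.commute)
qed

lemma cinner_add_right: "cinner x (y + z) = cinner x y + cinner x z"
  unfolding cinner_def coord_simps
  using infsum_add[OF cinner_summable[of x y] cinner_summable[of x z]] by (simp add: algebra_simps)

lemma cinner_scaleC_right: "cinner x (c *\<^sub>C y) = cnj c * cinner x y"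
proof -
  have "(\<Sum>\<^sub>\<infinity>l. cnj c * (coord x l * cnj (coord y l))) = cnj c * cinner x y"
    unfolding cinner_def by (rule infsum_cmult_right) (auto simp: cinner_summable)
  then show ?thesis by (simp add: cinner_def coord_simps mult_ac)
qed

lemma cinner_diff_right: "cinner x (y - z) = cinner x y - cinner x z"
  using cinner_add_right[of x "y - z" z] by simp

lemma cinner_diff_left: "cinner (y - z) x = cinner y x - cinner z x"
  by (metis cinner_cnj cinner_diff_right complex_cnj_diff)

lemma cinner_add_left: "cinner (y + z) x = cinner y x + cinner z x"
  by (metis cinner_cnj cinner_add_right complex_cnj_add)

lemma cinner_scaleC_left: "cinner (c *\<^sub>C y) x = c * cinner y x"
  by (metis cinner_cnj cinner_scaleC_right complex_cnj_mult complex_cnj_cnj)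

text \<open>As \<open>star_subalgebra\<close> quantifies over all adjoints of an element, uniqueness
  makes it enough to exhibit one of them in the set.\<close>

lemma is_adjoint_unique:
  assumes "is_adjoint A B" "is_adjoint A C"
  shows "B = C"
proof (intro blinfun_eqI ell2_eqI)
  fix y l
  have "cinner (E l) (B y) = cinner (E l) (C y)"
    using assms unfolding is_adjoint_def by metis
  then show "coord (B y) l = coord (C y) l"
    by (metis cinner_E cinner_cnj)
qed

lemma is_adjoint_diff: "is_adjoint A A' \<Longrightarrow> is_adjoint B B' \<Longrightarrow> is_adjoint (A - B) (A' - B')"
  by (simp add: is_adjoint_def blinfun.diff_left cinner_diff_left cinner_diff_right)

lemma is_adjoint_add: "is_adjoint A A' \<Longrightarrow> is_adjoint B B' \<Longrightarrow> is_adjoint (A + B) (A' + B')"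
  by (simp add: is_adjoint_def blinfun.add_left cinner_add_left cinner_add_right)

lemma is_adjoint_scaleC: "is_adjoint A A' \<Longrightarrow> is_adjoint (c *\<^sub>C A) (cnj c *\<^sub>C A')"
  by (simp add: is_adjoint_def scaleC_blinfun.rep_eq cinner_scaleC_left cinner_scaleC_right)

text \<open>Cauchy-Schwarz applied to the square of \<open>norm (A' y)\<close>, which equals the
  real inner product of \<open>A (A' y)\<close> and \<open>y\<close>. This makes adjoints of
  convergent sequences converge.\<close>

lemma norm_adjoint_le:
  assumes "is_adjoint A A'"
  shows "norm A' \<le> norm A"
proof (rule norm_blinfun_bound)
  fix y
  have "norm (A' y) * norm (A' y) = A (A' y) \<bullet> y"
    using assms by (metis Re_cinner is_adjoint_def norm_eq_square power2_eq_square power2_norm_eq_inner)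
  also have "\<dots> \<le> norm (A (A' y)) * norm y" by (rule norm_cauchy_schwarz)
  also have "\<dots> \<le> (norm A * norm (A' y)) * norm y" by (intro mult_right_mono norm_blinfun) simp
  finally have "norm (A' y) * norm (A' y) \<le> norm (A' y) * (norm A * norm y)" by (simp add: mult_ac)
  then show "norm (A' y) \<le> norm A * norm y"
    by (cases "norm (A' y) = 0") (auto simp: mult_nonneg_nonneg)
qed simp

section \<open>Laurent polynomials in the shift\<close>

lemma op_eqI: "(\<And>x l. coord (A x) l = coord (B x) l) \<Longrightarrow> A = B" for A B :: operator
  by (intro blinfun_eqI ell2_eqI)

lemma scaleC_comp_left: "(c *\<^sub>C A) o\<^sub>L B = c *\<^sub>C (A o\<^sub>L (B :: operator))" for A :: operator
  by (rule blinfun_eqI) (simp add: scaleC_blinfun.rep_eq)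

lemma scaleC_comp_right: "A \<in> bounded_ops \<Longrightarrow> A o\<^sub>L (c *\<^sub>C B) = c *\<^sub>C (A o\<^sub>L B)"
  by (rule blinfun_eqI) (simp add: scaleC_blinfun.rep_eq bounded_ops_iff)

lemma op_comp_assoc: "(A o\<^sub>L B) o\<^sub>L C = A o\<^sub>L (B o\<^sub>L (C :: operator))" for A B :: operator
  by (rule blinfun_eqI) simp

lemma op_comp_id [simp]: "id_blinfun o\<^sub>L A = A" "A o\<^sub>L id_blinfun = A" for A :: operator
  by (auto intro: blinfun_eqI)

lemma shift_shift: "shift a o\<^sub>L shift b = shift (a + b)"
  by (rule op_eqI) (simp add: algebra_simps)

lemma shift_0: "shift 0 = id_blinfun"
  by (rule op_eqI) simp

lemma norm_shift_le: "norm (shift k) \<le> 1"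
  by (rule norm_blinfun_bound) (simp_all add: shift.rep_eq norm_shift_ell2)

lemma coord_diag_op:
  assumes "bounded (range b)"
  shows "coord (diag_op b x) l = b l * coord x l"
proof -
  obtain K where "\<And>l. cmod (b l) \<le> K" using assms by (auto simp: bounded_iff)
  then show ?thesis by (rule diag_op_coord)
qed

lemma shift_in_bounded_ops: "shift k \<in> bounded_ops"
  by (auto simp: bounded_ops_iff coord_simps intro!: ell2_eqI)

lemma diag_op_in_bounded_ops: "bounded (range b) \<Longrightarrow> diag_op b \<in> bounded_ops"
  by (auto simp: bounded_ops_iff coord_simps coord_diag_op intro!: ell2_eqI)

lemma comp_in_bounded_ops: "A \<in> bounded_ops \<Longrightarrow> B \<in> bounded_ops \<Longrightarrow> A o\<^sub>L B \<in> bounded_ops"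
  by (simp add: bounded_ops_iff)

lemma subspace_bounded_ops: "complex_space.subspace bounded_ops"
  by (auto simp: complex_space.subspace_def bounded_ops_iff blinfun.add_left scaleC_blinfun.rep_eq
      scaleC_add_right scaleC_scaleC mult.commute)

lemma closed_bounded_ops: "closed bounded_ops"
proof (unfold closed_sequential_limits, intro allI impI)
  fix X and A :: operator assume "(\<forall>n. X n \<in> bounded_ops) \<and> X \<longlonglongrightarrow> A"
  then have X: "\<And>n. X n \<in> bounded_ops" and lim: "\<And>x. (\<lambda>n. X n x) \<longlonglongrightarrow> A x"
    by (auto intro!: blinfun.tendsto tendsto_const)
  have "A (c *\<^sub>C x) = c *\<^sub>C A x" for c x
  proof (rule LIMSEQ_unique[OF lim])
    show "(\<lambda>n. X n (c *\<^sub>C x)) \<longlonglongrightarrow> c *\<^sub>C A x"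
      using bounded_linear.tendsto[OF bounded_linear_scaleC lim] X by (simp add: bounded_ops_iff)
  qed
  then show "A \<in> bounded_ops" by (simp add: bounded_ops_iff)
qed

lemma bounded_range_mult:
  fixes a b :: "int \<Rightarrow> complex"
  assumes "bounded (range a)" "bounded (range b)"
  shows "bounded (range (\<lambda>l. a l * b l))"
proof -
  obtain K L where "\<And>l. norm (a l) \<le> K" "\<And>l. norm (b l) \<le> L"
    using assms by (auto simp: bounded_iff)
  then have "norm (a l * b l) \<le> K * L" for l
    unfolding norm_mult by (intro mult_mono) (auto intro: order_trans[OF norm_ge_zero])
  then show ?thesis by (auto simp: bounded_iff)
qed

lemma diag_op_diag_op:
  "bounded (range a) \<Longrightarrow> bounded (range b) \<Longrightarrow> diag_op a o\<^sub>L diag_op b = diag_op (\<lambda>l. a l * b l)"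
  by (rule op_eqI) (simp add: coord_diag_op bounded_range_mult)

lemma bounded_range_translate: "bounded (range b) \<Longrightarrow> bounded (range (\<lambda>l. b (l + k)))"
  for b :: "int \<Rightarrow> complex"
  by (rule bounded_subset) auto

lemma diag_op_shift:
  "bounded (range b) \<Longrightarrow> diag_op b o\<^sub>L shift k = shift k o\<^sub>L diag_op (\<lambda>l. b (l + k))"
  by (rule op_eqI) (simp add: coord_diag_op bounded_range_translate)

lemma is_adjoint_comp: "is_adjoint A A' \<Longrightarrow> is_adjoint B B' \<Longrightarrow> is_adjoint (A o\<^sub>L B) (B' o\<^sub>L A')"
  by (simp add: is_adjoint_def)

lemma is_adjoint_shift: "is_adjoint (shift k) (shift (- k))"
  unfolding is_adjoint_def
proof (intro allI)
  fix x y
  have "bij_betw (\<lambda>l. l + k) UNIV UNIV"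
    by (rule bij_betw_byWitness[where f' = "\<lambda>l. l - k"]) auto
  from infsum_reindex_bij_betw[OF this, of "\<lambda>l. coord x (l - k) * cnj (coord y l)"]
  show "cinner (shift k x) y = cinner x (shift (- k) y)" by (simp add: cinner_def)
qed

lemma is_adjoint_diag_op:
  assumes "bounded (range b)"
  shows "is_adjoint (diag_op b) (diag_op (\<lambda>l. cnj (b l)))"
proof -
  have "bounded (range (\<lambda>l. cnj (b l)))" using assms by (simp add: bounded_iff)
  then show ?thesis by (simp add: is_adjoint_def cinner_def coord_diag_op assms mult_ac)
qed

section \<open>Periodic coefficient sequences\<close>

definition periodic :: "nat \<Rightarrow> (int \<Rightarrow> complex) set" where
  "periodic j = {b. \<forall>l. b (l + int j) = b l}"

lemma periodic_add_mult:
  assumes "b \<in> periodic j"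
  shows "b (l + int j * k) = b l"
proof (induction k rule: int_induct[where k = 0])
  case (step1 i)
  then show ?case using assms[unfolded periodic_def, simplified, rule_format, of "l + int j * i"]
    by (simp add: algebra_simps)
next
  case (step2 i)
  then show ?case using assms[unfolded periodic_def, simplified, rule_format, of "l + int j * (i - 1)"]
    by (simp add: algebra_simps)
qed simp

lemma periodic_cong:
  assumes "b \<in> periodic j" "int j dvd k - l"
  shows "b k = b l"
proof -
  obtain m where "k - l = int j * m" using assms(2) by (elim dvdE)
  then have "k = l + int j * m" by simp
  then show ?thesis using periodic_add_mult[OF assms(1)] by simp
qed

lemma periodic_mod: "b \<in> periodic j \<Longrightarrow> b (l mod int j) = b l"
  by (erule periodic_cong) (simp add: mod_eq_dvd_iff[symmetric])

lemma periodic_dvd: "b \<in> periodic i \<Longrightarrow> i dvd j \<Longrightarrow> b \<in> periodic j"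
  unfolding periodic_def[of j] by (auto intro!: periodic_cong[of b i])

lemma bounded_periodic:
  assumes "b \<in> periodic j" "0 < j"
  shows "bounded (range b)"
proof -
  have "range b \<subseteq> b ` {0..<int j}"
  proof clarify
    fix l show "b l \<in> b ` {0..<int j}"
      using assms by (intro image_eqI[of _ _ "l mod int j"]) (simp_all add: periodic_mod)
  qed
  then show ?thesis by (rule bounded_subset[OF finite_imp_bounded, rotated]) simp
qed

lemma dvd_supernatural_1: "1 dvd\<^sub>s N"
  by (simp add: dvd_supernatural_def zero_enat_def[symmetric])

text \<open>The exponents of an lcm are maxima of exponents. Hence finitely many periods dividing
  \<open>N\<close> have a common multiple that still divides \<open>N\<close>.\<close>

lemma dvd_supernatural_lcm: "i dvd\<^sub>s N \<Longrightarrow> j dvd\<^sub>s N \<Longrightarrow> lcm i j dvd\<^sub>s N"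
  by (auto simp: dvd_supernatural_def multiplicity_lcm max_def lcm_pos_nat)

definition coeffs_BD :: "supernatural \<Rightarrow> (int \<Rightarrow> complex) set" where
  "coeffs_BD N = (\<Union>j\<in>{j. j dvd\<^sub>s N}. periodic j)"

lemma diag_BD_eq: "diag_BD N = diag_op ` coeffs_BD N"
  by (auto simp: diag_BD_def coeffs_BD_def periodic_def)

lemma bounded_coeffs_BD: "b \<in> coeffs_BD N \<Longrightarrow> bounded (range b)"
  by (auto simp: coeffs_BD_def dvd_supernatural_def intro: bounded_periodic)

lemma coeffs_BD_const: "(\<lambda>_. c) \<in> coeffs_BD N"
  using dvd_supernatural_1 by (auto simp: coeffs_BD_def periodic_def)

lemma periodic_translate: "b \<in> periodic j \<Longrightarrow> (\<lambda>l. b (l + k)) \<in> periodic j"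
  unfolding periodic_def[of j] by (auto intro!: periodic_cong[of b j] simp: periodic_def)

lemma coeffs_BD_translate: "b \<in> coeffs_BD N \<Longrightarrow> (\<lambda>l. b (l + k)) \<in> coeffs_BD N"
  by (auto simp: coeffs_BD_def intro: periodic_translate)

lemma coeffs_BD_cnj: "b \<in> coeffs_BD N \<Longrightarrow> (\<lambda>l. cnj (b l)) \<in> coeffs_BD N"
  by (auto simp: coeffs_BD_def periodic_def)

lemma coeffs_BD_mult:
  assumes "a \<in> coeffs_BD N" "b \<in> coeffs_BD N"
  shows "(\<lambda>l. a l * b l) \<in> coeffs_BD N"
proof -
  obtain i j where ij: "i dvd\<^sub>s N" "j dvd\<^sub>s N" and "a \<in> periodic i" "b \<in> periodic j"
    using assms by (auto simp: coeffs_BD_def)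
  then have "a \<in> periodic (lcm i j)" "b \<in> periodic (lcm i j)" by (auto intro: periodic_dvd)
  then have "(\<lambda>l. a l * b l) \<in> periodic (lcm i j)" by (simp add: periodic_def)
  then show ?thesis using dvd_supernatural_lcm[OF ij] by (auto simp: coeffs_BD_def)
qed

section \<open>The algebra of Laurent polynomials\<close>

definition monomials_BD :: "supernatural \<Rightarrow> operator set" where
  "monomials_BD N = {shift n o\<^sub>L diag_op b | n b. b \<in> coeffs_BD N}"

text \<open>An explicit form of the dense subalgebra, the finite sums of terms
  \<open>V^n b_n(L)\<close>. It is identified with \<open>alg_BD\<close> and its closure with
  \<open>BD\<close>, after which the hulls are no longer unfolded.\<close>

definition poly_BD :: "supernatural \<Rightarrow> operator set" where
  "poly_BD N = complex_space.span (monomials_BD N)"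

lemma monomial_in_poly_BD: "b \<in> coeffs_BD N \<Longrightarrow> shift n o\<^sub>L diag_op b \<in> poly_BD N"
  unfolding poly_BD_def monomials_BD_def by (rule complex_space.span_base) blast

lemma subspace_poly_BD: "complex_space.subspace (poly_BD N)"
  by (simp add: poly_BD_def)

text \<open>The induction principle for Laurent polynomials: a property stable under linear
  combinations has to be checked on monomials only.\<close>

lemma poly_BD_subset:
  assumes "complex_space.subspace S" "\<And>n b. b \<in> coeffs_BD N \<Longrightarrow> shift n o\<^sub>L diag_op b \<in> S"
  shows "poly_BD N \<subseteq> S"
  unfolding poly_BD_def using assms
  by (intro complex_space.span_minimal) (auto simp: monomials_BD_def)

lemma diag_op_1: "diag_op (\<lambda>_. 1) = id_blinfun"
  by (rule op_eqI) (simp add: coord_diag_op)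

lemma shift_in_poly_BD: "shift n \<in> poly_BD N"
  using monomial_in_poly_BD[OF coeffs_BD_const, of n 1 N] by (simp add: diag_op_1)

lemma diag_op_in_poly_BD: "b \<in> coeffs_BD N \<Longrightarrow> diag_op b \<in> poly_BD N"
  using monomial_in_poly_BD[of b N 0] by (simp add: shift_0)

lemma poly_BD_bounded_ops: "poly_BD N \<subseteq> bounded_ops"
  by (intro poly_BD_subset subspace_bounded_ops comp_in_bounded_ops shift_in_bounded_ops
      diag_op_in_bounded_ops bounded_coeffs_BD)

text \<open>Moving a diagonal operator past a shift only translates its coefficients, so products of
  monomials are again monomials.\<close>

lemma monomial_comp:
  assumes "a \<in> coeffs_BD N" "b \<in> coeffs_BD N"
  shows "(shift m o\<^sub>L diag_op a) o\<^sub>L (shift n o\<^sub>L diag_op b)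
    = shift (m + n) o\<^sub>L diag_op (\<lambda>l. a (l + n) * b l)"
proof -
  have "(shift m o\<^sub>L diag_op a) o\<^sub>L (shift n o\<^sub>L diag_op b)
      = shift m o\<^sub>L ((diag_op a o\<^sub>L shift n) o\<^sub>L diag_op b)" by (simp add: op_comp_assoc)
  also have "\<dots> = (shift m o\<^sub>L shift n) o\<^sub>L (diag_op (\<lambda>l. a (l + n)) o\<^sub>L diag_op b)"
    using assms by (simp add: op_comp_assoc diag_op_shift bounded_coeffs_BD)
  finally show ?thesis
    using diag_op_diag_op[OF bounded_coeffs_BD[OF coeffs_BD_translate[OF assms(1)]]
        bounded_coeffs_BD[OF assms(2)]]
    by (simp add: shift_shift)
qed

lemma poly_BD_comp:
  assumes "A \<in> poly_BD N" "B \<in> poly_BD N"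
  shows "A o\<^sub>L B \<in> poly_BD N"
proof -
  have mono: "poly_BD N \<subseteq> {B. (shift m o\<^sub>L diag_op a) o\<^sub>L B \<in> poly_BD N}"
    if a: "a \<in> coeffs_BD N" for m a
  proof (rule poly_BD_subset)
    \<comment> \<open>Composition is complex-linear in its right argument only when the left factor
      is complex-linear.\<close>
    have "shift m o\<^sub>L diag_op a \<in> bounded_ops"
      using poly_BD_bounded_ops monomial_in_poly_BD[OF a] by blast
    then show "complex_space.subspace {B. (shift m o\<^sub>L diag_op a) o\<^sub>L B \<in> poly_BD N}"
      using subspace_poly_BD
      by (auto simp: complex_space.subspace_def op_comp.add_right op_comp.zero_right scaleC_comp_right)
    show "shift n o\<^sub>L diag_op b \<in> {B. (shift m o\<^sub>L diag_op a) o\<^sub>L B \<in> poly_BD N}"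
      if "b \<in> coeffs_BD N" for n b
      using a that by (simp add: monomial_comp monomial_in_poly_BD coeffs_BD_mult coeffs_BD_translate)
  qed
  have "poly_BD N \<subseteq> {A. A o\<^sub>L B \<in> poly_BD N}"
  proof (rule poly_BD_subset)
    show "complex_space.subspace {A. A o\<^sub>L B \<in> poly_BD N}"
      using subspace_poly_BD
      by (auto simp: complex_space.subspace_def op_comp.add_left op_comp.zero_left scaleC_comp_left)
  qed (use mono assms(2) in blast)
  then show ?thesis using assms(1) by blast
qed

lemma poly_BD_adjoint:
  assumes "A \<in> poly_BD N"
  shows "\<exists>A'\<in>poly_BD N. is_adjoint A A'"
proof -
  have "poly_BD N \<subseteq> {A. \<exists>A'\<in>poly_BD N. is_adjoint A A'}"
  proof (rule poly_BD_subset)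
    have "is_adjoint 0 0" by (simp add: is_adjoint_def cinner_def coord_simps)
    then show "complex_space.subspace {A. \<exists>A'\<in>poly_BD N. is_adjoint A A'}"
      using subspace_poly_BD unfolding complex_space.subspace_def
      by (auto intro: is_adjoint_add is_adjoint_scaleC)
    fix n b assume b: "b \<in> coeffs_BD N"
    have "is_adjoint (shift n o\<^sub>L diag_op b) (diag_op (\<lambda>l. cnj (b l)) o\<^sub>L shift (- n))"
      by (intro is_adjoint_comp is_adjoint_shift is_adjoint_diag_op bounded_coeffs_BD[OF b])
    moreover have "diag_op (\<lambda>l. cnj (b l)) o\<^sub>L shift (- n) \<in> poly_BD N"
      by (intro poly_BD_comp shift_in_poly_BD diag_op_in_poly_BD coeffs_BD_cnj b)
    ultimately show "shift n o\<^sub>L diag_op b \<in> {A. \<exists>A'\<in>poly_BD N. is_adjoint A A'}" by blast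
  qed
  then show ?thesis using assms by blast
qed

lemma star_subalgebra_poly_BD: "star_subalgebra (poly_BD N)"
  unfolding star_subalgebra_def
  by (auto simp: subspace_poly_BD poly_BD_comp intro: poly_BD_bounded_ops[THEN subsetD])
    (metis poly_BD_adjoint is_adjoint_unique)

text \<open>\<open>V_inv\<close> enters \<open>S\<close> as the adjoint of \<open>V\<close>, so the
  lemma applies to the generators of both hulls, \<open>alg_BD\<close> and
  \<open>BD\<close>.\<close>

lemma poly_BD_minimal:
  assumes S: "star_subalgebra S" and gen: "{V} \<union> diag_BD N \<subseteq> S"
  shows "poly_BD N \<subseteq> S"
proof (rule poly_BD_subset)
  show "complex_space.subspace S" using S by (simp add: star_subalgebra_def)
  have comp: "A o\<^sub>L B \<in> S" if "A \<in> S" "B \<in> S" for A B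
    using S that by (auto simp: star_subalgebra_def)
  have V: "V \<in> S" using gen by simp
  then have V_inv: "V_inv \<in> S" using S is_adjoint_shift[of 1] by (auto simp: star_subalgebra_def)
  have "shift n \<in> S" for n
  proof (induction n rule: int_induct[where k = 0])
    case base
    show ?case using comp[OF V V_inv] by (simp add: shift_shift)
  next
    case (step1 i)
    show ?case using comp[OF step1(2) V] by (simp add: shift_shift)
  next
    case (step2 i)
    show ?case using comp[OF step2(2) V_inv] by (simp add: shift_shift)
  qed
  then show "shift n o\<^sub>L diag_op b \<in> S" if "b \<in> coeffs_BD N" for n b
    using gen that by (intro comp) (auto simp: diag_BD_eq)
qed

section \<open>Identification of the dense algebra and of its closure\<close>

lemma alg_BD_eq: "alg_BD N = poly_BD N"
  unfolding alg_BD_def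
proof (rule hull_unique)
  show "{V, V_inv} \<union> diag_BD N \<subseteq> poly_BD N"
    by (auto simp: diag_BD_eq diag_op_in_poly_BD shift_in_poly_BD)
qed (use star_subalgebra_poly_BD poly_BD_minimal in auto)

lemma star_subalgebra_closure_poly_BD: "star_subalgebra (closure (poly_BD N))"
  unfolding star_subalgebra_def
proof (intro conjI ballI allI impI)
  show "closure (poly_BD N) \<subseteq> bounded_ops"
    by (intro closure_minimal poly_BD_bounded_ops closed_bounded_ops)
  note sub = complex_space.subspace_add[OF subspace_poly_BD]
    complex_space.subspace_scale[OF subspace_poly_BD]
  show "complex_space.subspace (closure (poly_BD N))"
  proof (rule complex_space.subspaceI)
    show "0 \<in> closure (poly_BD N)"
      using complex_space.subspace_0[OF subspace_poly_BD] closure_subset by blast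
    show "A + B \<in> closure (poly_BD N)" if *: "A \<in> closure (poly_BD N)" "B \<in> closure (poly_BD N)" for A B
    proof -
      obtain X Y where "\<And>n. X n \<in> poly_BD N" "X \<longlonglongrightarrow> A" "\<And>n. Y n \<in> poly_BD N" "Y \<longlonglongrightarrow> B"
        using * unfolding closure_sequential by blast
      then show ?thesis
        unfolding closure_sequential
        by (intro exI[of _ "\<lambda>n. X n + Y n"]) (simp add: tendsto_add sub)
    qed
    show "c *\<^sub>C A \<in> closure (poly_BD N)" if *: "A \<in> closure (poly_BD N)" for c A
    proof -
      obtain X where "\<And>n. X n \<in> poly_BD N" "X \<longlonglongrightarrow> A"
        using * by (auto simp: closure_sequential)
      then show ?thesis
        unfolding closure_sequential
        by (intro exI[of _ "\<lambda>n. c *\<^sub>C X n"]) (simp add: sub bounded_linear.tendsto[OF bounded_linear_scaleC])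
    qed
  qed
  show "A o\<^sub>L B \<in> closure (poly_BD N)" if *: "A \<in> closure (poly_BD N)" "B \<in> closure (poly_BD N)" for A B
  proof -
    obtain X Y where "\<And>n. X n \<in> poly_BD N" "X \<longlonglongrightarrow> A" "\<And>n. Y n \<in> poly_BD N" "Y \<longlonglongrightarrow> B"
      using * unfolding closure_sequential by blast
    then show ?thesis
      unfolding closure_sequential
      by (intro exI[of _ "\<lambda>n. X n o\<^sub>L Y n"]) (simp add: op_comp.tendsto poly_BD_comp)
  qed
  fix A A' assume "A \<in> closure (poly_BD N)" and adj: "is_adjoint A A'"
  then obtain X where X: "\<And>n. X n \<in> poly_BD N" "X \<longlonglongrightarrow> A" by (auto simp: closure_sequential)
  obtain Y where Y: "\<And>n. Y n \<in> poly_BD N" "\<And>n. is_adjoint (X n) (Y n)"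
    using poly_BD_adjoint[OF X(1)] by metis
  \<comment> \<open>The difference of the adjoints is an adjoint of \<open>X n - A\<close>, so its
    norm is at most that of \<open>X n - A\<close>.\<close>
  have "(\<lambda>n. Y n - A') \<longlonglongrightarrow> 0"
  proof (rule Lim_null_comparison)
    show "\<forall>\<^sub>F n in sequentially. norm (Y n - A') \<le> norm (X n - A)"
      by (intro always_eventually allI norm_adjoint_le is_adjoint_diff Y adj)
    show "(\<lambda>n. norm (X n - A)) \<longlonglongrightarrow> 0"
      using X(2) by (simp add: LIM_zero tendsto_norm_zero)
  qed
  then have "Y \<longlonglongrightarrow> A'" by (rule LIM_zero_cancel)
  then show "A' \<in> closure (poly_BD N)" using Y(1) by (auto simp: closure_sequential)
qed

lemma BD_eq: "BD N = closure (poly_BD N)"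
  unfolding BD_def
proof (rule hull_unique)
  show "{V} \<union> diag_BD N \<subseteq> closure (poly_BD N)"
    using closure_subset[of "poly_BD N"] by (auto simp: diag_BD_eq diag_op_in_poly_BD shift_in_poly_BD)
  show "closure (poly_BD N) \<subseteq> S" if "{V} \<union> diag_BD N \<subseteq> S" "star_subalgebra S \<and> closed S" for S
    using that by (intro closure_minimal poly_BD_minimal) simp_all
qed (simp add: star_subalgebra_closure_poly_BD)

lemma closed_BD: "closed (BD N)" by (simp add: BD_eq)

lemma subspace_BD: "complex_space.subspace (BD N)"
  using star_subalgebra_closure_poly_BD by (simp add: BD_eq star_subalgebra_def)

lemma BD_bounded_ops: "A \<in> BD N \<Longrightarrow> A \<in> bounded_ops"
  using star_subalgebra_closure_poly_BD[of N] unfolding BD_eq star_subalgebra_def by blast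

lemma BD_comp: "A \<in> BD N \<Longrightarrow> B \<in> BD N \<Longrightarrow> A o\<^sub>L B \<in> BD N"
  using star_subalgebra_closure_poly_BD by (simp add: BD_eq star_subalgebra_def)

lemmas BD_add = complex_space.subspace_add[OF subspace_BD]
  and BD_diff = complex_space.subspace_diff[OF subspace_BD]
  and BD_sum = complex_space.subspace_sum[OF subspace_BD]
  and BD_scaleC = complex_space.subspace_scale[OF subspace_BD]

lemma BD_scaleR: "A \<in> BD N \<Longrightarrow> r *\<^sub>R A \<in> BD N"
  using BD_scaleC[of A N "complex_of_real r"] by (simp add: scaleC_of_real)

lemma poly_BD_in_BD: "A \<in> poly_BD N \<Longrightarrow> A \<in> BD N"
  using closure_subset by (auto simp: BD_eq)

lemma shift_in_BD: "shift n \<in> BD N"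
  by (intro poly_BD_in_BD shift_in_poly_BD)

section \<open>Averaging over conjugation by the shift\<close>

text \<open>The power \<alpha>^k of the automorphism \<alpha> from the overview.\<close>

definition conj_V :: "int \<Rightarrow> operator \<Rightarrow> operator" where
  "conj_V k T = shift k o\<^sub>L T o\<^sub>L shift (- k)"

lemma bounded_linear_conj_V: "bounded_linear (conj_V k)"
proof -
  have "bounded_linear (\<lambda>T. (shift k o\<^sub>L T) o\<^sub>L shift (- k))"
    by (rule bounded_linear_compose[OF op_comp.bounded_linear_left op_comp.bounded_linear_right])
  then show ?thesis by (simp add: conj_V_def[abs_def])
qed

lemmas linear_conj_V = bounded_linear.linear[OF bounded_linear_conj_V]
lemmas conj_V_zero = linear_0[OF linear_conj_V]
  and conj_V_add = linear_add[OF linear_conj_V]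
  and conj_V_diff = linear_diff[OF linear_conj_V]
  and conj_V_scaleR = linear_scale[OF linear_conj_V]
  and conj_V_sum = linear_sum[OF linear_conj_V]

lemma conj_V_conj_V: "conj_V m (conj_V n T) = conj_V (m + n) T"
proof -
  have "conj_V m (conj_V n T) = (shift m o\<^sub>L shift n) o\<^sub>L T o\<^sub>L (shift (- n) o\<^sub>L shift (- m))"
    by (simp add: conj_V_def op_comp_assoc)
  moreover have "- n + - m = - (m + n)" by simp
  ultimately show ?thesis by (simp only: shift_shift conj_V_def)
qed

lemma conj_V_0 [simp]: "conj_V 0 T = T"
  by (simp add: conj_V_def shift_0)

lemma norm_conj_V_le: "norm (conj_V k T) \<le> norm T"
proof -
  have "norm (conj_V k T) \<le> norm (shift k o\<^sub>L T) * norm (shift (- k))"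
    unfolding conj_V_def by (rule norm_blinfun_compose)
  also have "\<dots> \<le> norm (shift k o\<^sub>L T) * 1"
    by (intro mult_left_mono norm_shift_le) simp
  also have "\<dots> \<le> norm (shift k) * norm T"
    using norm_blinfun_compose by simp
  also have "\<dots> \<le> 1 * norm T"
    by (intro mult_right_mono norm_shift_le) simp
  finally show ?thesis by simp
qed

lemma conj_V_in_BD: "T \<in> BD N \<Longrightarrow> conj_V k T \<in> BD N"
  unfolding conj_V_def by (intro BD_comp shift_in_BD)

text \<open>Shifts commute with each other, so conjugation only translates the coefficients; a
  \<open>j\<close>-periodic coefficient is therefore left alone by \<open>conj_V j\<close>.\<close>

lemma conj_V_monomial:
  assumes "b \<in> coeffs_BD N"
  shows "conj_V k (shift n o\<^sub>L diag_op b) = shift n o\<^sub>L diag_op (\<lambda>l. b (l - k))"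
proof -
  have "bounded (range (\<lambda>l. b (l - k)))"
    using bounded_range_translate[OF bounded_coeffs_BD[OF assms], of "- k"] by simp
  then show ?thesis
    unfolding conj_V_def
    by (intro op_eqI) (simp add: coord_diag_op bounded_coeffs_BD[OF assms] algebra_simps)
qed

lemma conj_V_fixed_mult: "conj_V k T = T \<Longrightarrow> conj_V (int n * k) T = T"
  by (induction n) (simp_all add: algebra_simps conj_V_conj_V[symmetric])

lemma conj_V_fixed_dvd: "conj_V (int i) T = T \<Longrightarrow> i dvd j \<Longrightarrow> conj_V (int j) T = T"
  using conj_V_fixed_mult by (metis dvd_def mult.commute of_nat_mult)

text \<open>Only finitely many coefficients occur, and the lcm of their periods divides
  \<open>N\<close>. This periodicity under conjugation is what makes the averages stabilize.\<close>

lemma poly_BD_conj_V_fixed: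
  assumes "T \<in> poly_BD N"
  shows "\<exists>j. j dvd\<^sub>s N \<and> conj_V (int j) T = T"
proof -
  have "poly_BD N \<subseteq> {T. T \<in> bounded_ops \<and> (\<exists>j. j dvd\<^sub>s N \<and> conj_V (int j) T = T)}"
    (is "_ \<subseteq> ?S")
  proof (rule poly_BD_subset)
    show "complex_space.subspace ?S"
    proof (rule complex_space.subspaceI)
      show "0 \<in> ?S"
        using dvd_supernatural_1 complex_space.subspace_0[OF subspace_bounded_ops]
        by (auto simp: conj_V_zero)
      fix A B c assume A: "A \<in> ?S"
      then obtain i where i: "i dvd\<^sub>s N" "conj_V (int i) A = A" by blast
      show "c *\<^sub>C A \<in> ?S"
        using i A
        by (auto simp: conj_V_def scaleC_comp_left scaleC_comp_right shift_in_bounded_ops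
            intro!: complex_space.subspace_scale[OF subspace_bounded_ops])
      assume B: "B \<in> ?S"
      then obtain j where j: "j dvd\<^sub>s N" "conj_V (int j) B = B" by blast
      have "conj_V (int (lcm i j)) (A + B) = A + B"
        using conj_V_fixed_dvd[OF i(2), of "lcm i j"] conj_V_fixed_dvd[OF j(2), of "lcm i j"]
        by (simp add: conj_V_add)
      then show "A + B \<in> ?S"
        using A B dvd_supernatural_lcm[OF i(1) j(1)] complex_space.subspace_add[OF subspace_bounded_ops]
        by blast
    qed
    fix n b assume b: "b \<in> coeffs_BD N"
    then obtain j where j: "j dvd\<^sub>s N" "b \<in> periodic j" by (auto simp: coeffs_BD_def)
    have "b (l - int j) = b l" for l
      by (rule periodic_cong[OF j(2)]) simp
    then show "shift n o\<^sub>L diag_op b \<in> ?S"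
      using j(1) monomial_in_poly_BD[OF b] poly_BD_bounded_ops
      by (auto simp: conj_V_monomial[OF b])
  qed
  then show ?thesis using assms by blast
qed

section \<open>Averages and coboundaries\<close>

definition average :: "nat \<Rightarrow> operator \<Rightarrow> operator" where
  "average M T = (1 / real M) *\<^sub>R (\<Sum>i<M. conj_V (int i) T)"

lemma average_diff: "average M (S - T) = average M S - average M T"
  by (simp add: average_def conj_V_diff sum_subtractf scaleR_diff_right)

lemma norm_average_le: "norm (average M T) \<le> norm T"
proof (cases "M = 0")
  case False
  have "norm (\<Sum>i<M. conj_V (int i) T) \<le> (\<Sum>i<M. norm T)"
    by (intro sum_norm_le norm_conj_V_le)
  then show ?thesis using False by (simp add: average_def divide_simps mult.commute)
qed (simp add: average_def)

text \<open>Telescoping leaves the two end terms, whose norms stay bounded as \<open>M\<close>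
  grows; dividing by \<open>M\<close> makes averages of coboundaries vanish in the limit.\<close>

lemma average_coboundary:
  "average M (T - conj_V 1 T) = (1 / real M) *\<^sub>R (T - conj_V (int M) T)"
proof -
  have "(\<Sum>i<M. conj_V (int i) (T - conj_V 1 T))
      = (\<Sum>i<M. conj_V (int i) T - conj_V (int (Suc i)) T)"
    by (simp add: conj_V_diff conj_V_conj_V algebra_simps)
  also have "\<dots> = T - conj_V (int M) T"
    by (subst sum_lessThan_telescope') simp
  finally show ?thesis by (simp add: average_def)
qed

lemma norm_average_coboundary_le: "norm (average M (T - conj_V 1 T)) \<le> 2 * norm T / real M"
proof -
  have "norm (T - conj_V (int M) T) \<le> 2 * norm T"
    using norm_triangle_ineq4[of T "conj_V (int M) T"] norm_conj_V_le[of "int M" T] by linarith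
  then show ?thesis
    unfolding average_coboundary by (simp add: divide_right_mono)
qed

text \<open>The conjugates repeat with period \<open>j\<close>, so the long sum consists of
  \<open>q\<close> blocks with equal sums.\<close>

lemma average_fixed:
  assumes "conj_V (int j) T = T" "0 < q"
  shows "average (j * q) T = average j T"
proof -
  have "(\<Sum>i\<in>{m * j..<m * j + j}. conj_V (int i) T) = (\<Sum>i<j. conj_V (int i) T)" for m
  proof -
    have "(\<Sum>i\<in>{m * j..<m * j + j}. conj_V (int i) T) = (\<Sum>i<j. conj_V (int (i + m * j)) T)"
      using sum.shift_bounds_nat_ivl[of "\<lambda>i. conj_V (int i) T" 0 "m * j" j]
      by (simp add: atLeast0LessThan add.commute)
    also have "\<dots> = (\<Sum>i<j. conj_V (int i) T)"
      using conj_V_fixed_mult[OF assms(1), of m] by (simp add: conj_V_conj_V[symmetric])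
    finally show ?thesis .
  qed
  then have "(\<Sum>i<q * j. conj_V (int i) T) = real q *\<^sub>R (\<Sum>i<j. conj_V (int i) T)"
    by (simp add: sum.nat_group[symmetric] sum_constant_scaleR)
  then show ?thesis using assms(2) by (simp add: average_def mult.commute)
qed

section \<open>A divisibility chain of divisors of N\<close>

lemma dvd_supernatural_Lcm:
  assumes "finite S" "\<And>j. j \<in> S \<Longrightarrow> j dvd\<^sub>s N"
  shows "Lcm S dvd\<^sub>s N"
  using assms by (induction S) (auto simp: dvd_supernatural_1[simplified] dvd_supernatural_lcm)

text \<open>A canonical cofinal chain: every term divides \<open>N\<close>, and each divisor of
  \<open>N\<close> divides all terms from some index on.\<close>

definition divisor_chain :: "supernatural \<Rightarrow> nat \<Rightarrow> nat" where
  "divisor_chain N k = Lcm {j. j dvd\<^sub>s N \<and> j \<le> k}"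

lemma divisor_chain_dvd_supernatural: "divisor_chain N k dvd\<^sub>s N"
  unfolding divisor_chain_def
  by (rule dvd_supernatural_Lcm) (auto intro: finite_subset[of _ "{..k}"])

lemma divisor_chain_pos: "0 < divisor_chain N k"
  using divisor_chain_dvd_supernatural[of N k] by (simp add: dvd_supernatural_def)

lemma dvd_divisor_chain: "j dvd\<^sub>s N \<Longrightarrow> j \<le> k \<Longrightarrow> j dvd divisor_chain N k"
  unfolding divisor_chain_def by (rule dvd_Lcm) simp

text \<open>If all divisors of \<open>N\<close> divided \<open>m\<close>, every exponent of
  \<open>N\<close> would be at most that of \<open>m\<close>. The exponents would then be finite and
  vanish off the primes dividing \<open>m\<close>, so their sum would be finite.\<close>

lemma infinite_supernatural_not_dvd:
  assumes "infinite_supernatural N" "0 < m"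
  shows "\<exists>j. j dvd\<^sub>s N \<and> \<not> j dvd m"
proof (rule ccontr)
  assume "\<not> ?thesis"
  then have dvd: "j dvd m" if "j dvd\<^sub>s N" for j using that by blast
  have le: "N p \<le> enat (multiplicity p m)" if p: "prime p" for p
  proof (rule ccontr)
    \<comment> \<open>One more than the exponent in \<open>m\<close>, so that \<open>p ^ e\<close>
      cannot divide \<open>m\<close>.\<close>
    define e where "e = Suc (multiplicity p m)"
    assume "\<not> N p \<le> enat (multiplicity p m)"
    then have "enat e \<le> N p" by (simp add: e_def Suc_ile_eq)
    then have "enat (multiplicity q (p ^ e)) \<le> N q" if "prime q" for q
      using p that
      by (cases "q = p")
        (simp_all add: multiplicity_same_power multiplicity_distinct_prime_power zero_enat_def[symmetric])
    then have "p ^ e dvd\<^sub>s N"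
      using p by (simp add: dvd_supernatural_def prime_gt_0_nat)
    then have "p ^ e dvd m" by (rule dvd)
    then have "e \<le> multiplicity p m"
      using assms(2) p by (intro multiplicity_geI) auto
    then show False by (simp add: e_def)
  qed
  have "(\<Sum>\<^sub>\<infinity>p\<in>{p. prime p}. N p) = (\<Sum>\<^sub>\<infinity>p\<in>prime_factors m. N p)"
  proof (rule infsum_cong_neutral)
    fix p assume "p \<in> {p. prime p} - prime_factors m"
    then have "multiplicity p m = 0" "prime p"
      using assms(2) by (auto simp: prime_factors_multiplicity)
    then show "N p = 0" using le[of p] by (simp add: zero_enat_def[symmetric])
  qed (auto simp: in_prime_factors_iff)
  also have "\<dots> = (\<Sum>p\<in>prime_factors m. N p)" by simp
  also have "\<dots> \<le> (\<Sum>p\<in>prime_factors m. enat (multiplicity p m))"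
    by (intro sum_mono le) auto
  also have "\<dots> = enat (\<Sum>p\<in>prime_factors m. multiplicity p m)"
    by (simp add: of_nat_eq_enat[symmetric])
  also have "\<dots> < \<infinity>" by simp
  finally show False using assms(1) by (simp add: infinite_supernatural_def)
qed

lemma filterlim_divisor_chain:
  assumes "infinite_supernatural N"
  shows "filterlim (divisor_chain N) at_top sequentially"
  unfolding filterlim_at_top
proof
  fix B :: nat
  \<comment> \<open>Every positive number below \<open>B\<close> divides \<open>fact B\<close>. From
    index \<open>j\<close> on, the terms are multiples of \<open>j\<close> and so do not divide
    \<open>fact B\<close>; hence they are at least \<open>B\<close>.\<close>
  obtain j where j: "j dvd\<^sub>s N" "\<not> j dvd fact B"
    using infinite_supernatural_not_dvd[OF assms, of "fact B"] by auto
  have "B \<le> divisor_chain N k" if "j \<le> k" for k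
  proof (rule ccontr)
    assume "\<not> ?thesis"
    then have "divisor_chain N k dvd fact B"
      using divisor_chain_pos[of N k] by (intro dvd_fact) auto
    then show False using j dvd_divisor_chain[OF j(1) that] dvd_trans by blast
  qed
  then show "\<forall>\<^sub>F k in sequentially. B \<le> divisor_chain N k"
    by (auto simp: eventually_sequentially)
qed

text \<open>Along the divisor chain the averages of a Laurent polynomial are eventually constant.\<close>

lemma convergent_average:
  assumes T: "T \<in> BD N"
  shows "convergent (\<lambda>k. average (divisor_chain N k) T)"
proof (rule Cauchy_convergent, rule CauchyI)
  fix e :: real assume "0 < e"
  then obtain P where P: "P \<in> poly_BD N" "dist P T < e / 2"
    using T unfolding BD_eq closure_approachable by (metis half_gt_zero)
  obtain j where j: "j dvd\<^sub>s N" "conj_V (int j) P = P" using poly_BD_conj_V_fixed[OF P(1)] by blast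
  \<comment> \<open>From index \<open>j\<close> on, the averages of \<open>P\<close> all equal
    \<open>average j P\<close>, and averaging does not enlarge the distance from \<open>T\<close> to
    \<open>P\<close>.\<close>
  have close: "norm (average (divisor_chain N k) T - average j P) < e / 2" if k: "j \<le> k" for k
  proof -
    obtain q where q: "divisor_chain N k = j * q" using dvd_divisor_chain[OF j(1) k] by (elim dvdE)
    then have "0 < q" using divisor_chain_pos[of N k] by (auto intro: gr0I)
    then have "average (divisor_chain N k) P = average j P" unfolding q by (rule average_fixed[OF j(2)])
    then have "norm (average (divisor_chain N k) T - average j P) \<le> norm (T - P)"
      using norm_average_le[of "divisor_chain N k" "T - P"] by (simp add: average_diff)
    then show ?thesis using P(2) by (simp add: dist_norm norm_minus_commute)
  qed
  have "norm (average (divisor_chain N m) T - average (divisor_chain N n) T) < e"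
    if "j \<le> m" "j \<le> n" for m n
    using norm_triangle_half_l[of _ "average j P"] close[OF that(1)] close[OF that(2)] \<open>0 < e\<close>
    by (simp add: norm_minus_commute)
  then show "\<exists>M. \<forall>m\<ge>M. \<forall>n\<ge>M.
      norm (average (divisor_chain N m) T - average (divisor_chain N n) T) < e" by blast
qed

lemma average_coboundary_tendsto_0:
  assumes "infinite_supernatural N"
  shows "(\<lambda>k. average (divisor_chain N k) (T - conj_V 1 T)) \<longlonglongrightarrow> 0"
proof (rule Lim_null_comparison)
  show "\<forall>\<^sub>F k in sequentially. norm (average (divisor_chain N k) (T - conj_V 1 T))
      \<le> 2 * norm T / real (divisor_chain N k)"
    by (intro always_eventually allI norm_average_coboundary_le)
  show "(\<lambda>k. 2 * norm T / real (divisor_chain N k)) \<longlonglongrightarrow> 0"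
    by (intro tendsto_divide_0[OF tendsto_const] filterlim_at_top_imp_at_infinity
        filterlim_compose[OF filterlim_real_sequentially filterlim_divisor_chain] assms)
qed

section \<open>Solving the coboundary equation up to an average\<close>

definition corrector :: "nat \<Rightarrow> operator \<Rightarrow> operator" where
  "corrector M T = (1 / real M) *\<^sub>R (\<Sum>m<M. \<Sum>i<m. conj_V (int i) T)"

text \<open>The corrector is the mean of the partial orbit sums of lengths 0 to
  \<open>M - 1\<close>. The coboundary of the sum of length \<open>m\<close> telescopes to
  \<open>T - conj_V m T\<close>, and the mean over \<open>m\<close> gives the claim.\<close>

lemma corrector_coboundary:
  assumes "0 < M"
  shows "corrector M T - conj_V 1 (corrector M T) = T - average M T"
proof -
  have "corrector M T - conj_V 1 (corrector M T)
      = (1 / real M) *\<^sub>R (\<Sum>m<M. \<Sum>i<m. conj_V (int i) T - conj_V (int (Suc i)) T)"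
    by (simp add: corrector_def conj_V_scaleR conj_V_sum conj_V_conj_V scaleR_diff_right
        sum_subtractf)
  also have "\<dots> = (1 / real M) *\<^sub>R (\<Sum>m<M. T - conj_V (int m) T)"
    by (subst sum_lessThan_telescope') simp
  also have "\<dots> = T - average M T"
    using assms by (simp add: average_def sum_subtractf scaleR_diff_right sum_constant_scaleR)
  finally show ?thesis .
qed

lemma corrector_in_BD: "T \<in> BD N \<Longrightarrow> corrector M T \<in> BD N"
  unfolding corrector_def by (intro BD_scaleR BD_sum conj_V_in_BD)

lemma average_in_BD: "T \<in> BD N \<Longrightarrow> average M T \<in> BD N"
  unfolding average_def by (intro BD_scaleR BD_sum conj_V_in_BD)

section \<open>The commutator with the number operator\<close>

text \<open>A coordinatewise substitute for membership in the span of the basis, on which the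
  unbounded number operator can be computed directly.\<close>

definition finite_support :: "ell2 \<Rightarrow> bool" where
  "finite_support x \<longleftrightarrow> finite {l. coord x l \<noteq> 0}"

lemma finite_support_add: "finite_support x \<Longrightarrow> finite_support y \<Longrightarrow> finite_support (x + y)"
  unfolding finite_support_def
  by (rule finite_subset[of _ "{l. coord x l \<noteq> 0} \<union> {l. coord y l \<noteq> 0}"]) (auto simp: coord_simps)

lemma finite_support_scaleC: "finite_support x \<Longrightarrow> finite_support (c *\<^sub>C x)"
  unfolding finite_support_def
  by (rule finite_subset[of _ "{l. coord x l \<noteq> 0}"]) (auto simp: coord_simps)

lemma finite_support_0: "finite_support 0"
  by (simp add: finite_support_def coord_simps)

lemma finite_support_span: "x \<in> complex_space.span (range E) \<Longrightarrow> finite_support x"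
proof (induction rule: complex_space.span_induct_alt)
  case (step c x y)
  then have "finite_support x" by (auto simp: finite_support_def coord_simps)
  then show ?case using step by (intro finite_support_add finite_support_scaleC) auto
qed (rule finite_support_0)

text \<open>Finite support makes the product square-summable, so that \<open>Abs_ell2\<close> is
  applied inside its domain.\<close>

lemma coord_number_op:
  assumes "finite_support x"
  shows "coord (number_op x) l = of_int l * coord x l"
proof -
  have "(\<lambda>l. (cmod (of_int l * coord x l))\<^sup>2) summable_on UNIV"
    using assms
    by (subst summable_on_cong_neutral[where T = "{l. coord x l \<noteq> 0}"])
      (auto simp: finite_support_def)
  then show ?thesis by (simp add: number_op_def mult_ell2_def Abs_ell2_inverse)
qed

lemma number_op_add:
  "finite_support x \<Longrightarrow> finite_support y \<Longrightarrow> number_op (x + y) = number_op x + number_op y"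
  by (rule ell2_eqI) (simp add: coord_number_op finite_support_add coord_simps algebra_simps)

lemma number_op_scaleC: "finite_support x \<Longrightarrow> number_op (c *\<^sub>C x) = c *\<^sub>C number_op x"
  by (rule ell2_eqI) (simp add: coord_number_op finite_support_scaleC coord_simps)

text \<open>A relational form of \<open>L_commutator\<close> that avoids the definite description.
  Invariance of finite support is included so that \<open>number_op (b x)\<close> is meaningful and
  products can be handled.\<close>

definition is_L_commutator :: "operator \<Rightarrow> operator \<Rightarrow> bool" where
  "is_L_commutator b D \<longleftrightarrow> D \<in> bounded_ops \<and> (\<forall>x. finite_support x \<longrightarrow>
     finite_support (b x) \<and> D x = number_op (b x) - b (number_op x))"

lemma L_commutator_eqI:
  assumes "is_L_commutator b D"
  shows "L_commutator b = D"
  unfolding L_commutator_def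
proof (rule the_equality)
  show "D \<in> bounded_ops \<and> (\<forall>x\<in>complex_space.span (range E). D x = number_op (b x) - b (number_op x))"
    using assms finite_support_span by (auto simp: is_L_commutator_def)
  fix D' assume D': "D' \<in> bounded_ops \<and>
    (\<forall>x\<in>complex_space.span (range E). D' x = number_op (b x) - b (number_op x))"
  show "D' = D"
  proof (rule bounded_ops_eqI)
    fix l
    have l: "E l \<in> complex_space.span (range E)" by (rule complex_space.span_base) simp
    then show "D' (E l) = D (E l)"
      using D' assms finite_support_span[OF l] by (auto simp: is_L_commutator_def)
  qed (use D' assms in \<open>auto simp: is_L_commutator_def\<close>)
qed

lemma is_L_commutator_add:
  assumes "is_L_commutator a D" "is_L_commutator b F"
  shows "is_L_commutator (a + b) (D + F)"
  using assms complex_space.subspace_add[OF subspace_bounded_ops]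
  by (auto simp: is_L_commutator_def blinfun.add_left finite_support_add number_op_add)

lemma is_L_commutator_scaleC:
  assumes "is_L_commutator a D"
  shows "is_L_commutator (c *\<^sub>C a) (c *\<^sub>C D)"
  using assms complex_space.subspace_scale[OF subspace_bounded_ops]
  by (auto simp: is_L_commutator_def scaleC_blinfun.rep_eq finite_support_scaleC number_op_scaleC
      complex_space.scale_right_diff_distrib)

text \<open>The Leibniz rule follows by inserting \<open>a (number_op (b x))\<close>;
  \<open>b x\<close> has finite support, so the relation for \<open>a\<close> applies to it.\<close>

lemma is_L_commutator_comp:
  assumes "is_L_commutator a D" "is_L_commutator b F" "a \<in> bounded_ops" "b \<in> bounded_ops"
  shows "is_L_commutator (a o\<^sub>L b) ((D o\<^sub>L b) + (a o\<^sub>L F))"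
  using assms complex_space.subspace_add[OF subspace_bounded_ops] comp_in_bounded_ops
  by (auto simp: is_L_commutator_def blinfun.add_left blinfun.diff_right)

text \<open>The diagonal factor commutes with the number operator, while \<open>shift n\<close>
  raises every index by \<open>n\<close>.\<close>

lemma is_L_commutator_monomial:
  assumes b: "b \<in> coeffs_BD N"
  shows "is_L_commutator (shift n o\<^sub>L diag_op b) (of_int n *\<^sub>C (shift n o\<^sub>L diag_op b))"
    (is "is_L_commutator ?a _")
  unfolding is_L_commutator_def
proof (intro conjI allI impI)
  show "of_int n *\<^sub>C ?a \<in> bounded_ops"
    using poly_BD_bounded_ops monomial_in_poly_BD[OF b] complex_space.subspace_scale[OF subspace_bounded_ops]
    by blast
  note coord = coord_diag_op[OF bounded_coeffs_BD[OF b]]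
  fix x assume x: "finite_support x"
  show fin: "finite_support (?a x)"
    unfolding finite_support_def
  proof (rule finite_subset)
    show "{l. coord (?a x) l \<noteq> 0} \<subseteq> (\<lambda>l. l + n) ` {l. coord x l \<noteq> 0}"
      by (auto simp: coord intro!: image_eqI[of _ _ "l - n" for l])
  qed (use x in \<open>simp add: finite_support_def\<close>)
  show "(of_int n *\<^sub>C ?a) x = number_op (?a x) - ?a (number_op x)"
    using fin x
    by (intro ell2_eqI) (simp add: coord_number_op coord coord_simps scaleC_blinfun.rep_eq algebra_simps)
qed

lemma is_L_commutator_exists:
  assumes "a \<in> poly_BD N"
  shows "\<exists>D\<in>poly_BD N. is_L_commutator a D"
proof -
  have "poly_BD N \<subseteq> {a. \<exists>D\<in>poly_BD N. is_L_commutator a D}"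
  proof (rule poly_BD_subset)
    have "is_L_commutator 0 0"
      using complex_space.subspace_0[OF subspace_bounded_ops] finite_support_0
      by (auto simp: is_L_commutator_def intro!: ell2_eqI simp: coord_number_op coord_simps)
    then show "complex_space.subspace {a. \<exists>D\<in>poly_BD N. is_L_commutator a D}"
      using subspace_poly_BD unfolding complex_space.subspace_def
      by (auto intro: is_L_commutator_add is_L_commutator_scaleC)
    show "shift n o\<^sub>L diag_op b \<in> {a. \<exists>D\<in>poly_BD N. is_L_commutator a D}"
      if "b \<in> coeffs_BD N" for n b
      using is_L_commutator_monomial[OF that] monomial_in_poly_BD[OF that]
        complex_space.subspace_scale[OF subspace_poly_BD] by blast
  qed
  then show ?thesis using assms by blast
qed

lemma is_L_commutator_L_commutator:
  assumes "a \<in> alg_BD N"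
  shows "is_L_commutator a (L_commutator a)" and "L_commutator a \<in> alg_BD N"
proof -
  obtain D where "D \<in> poly_BD N" "is_L_commutator a D"
    using is_L_commutator_exists assms unfolding alg_BD_eq by blast
  then show "is_L_commutator a (L_commutator a)" "L_commutator a \<in> alg_BD N"
    by (simp_all add: alg_BD_eq L_commutator_eqI)
qed

lemma L_commutator_V: "L_commutator V = V"
  using L_commutator_eqI[OF is_L_commutator_monomial[OF coeffs_BD_const, of 1 1]]
  by (simp add: diag_op_1 scaleC_one)

lemma L_commutator_diag_op:
  assumes "b \<in> coeffs_BD N"
  shows "L_commutator (diag_op b) = 0"
  using L_commutator_eqI[OF is_L_commutator_monomial[OF assms, of 0]] by (simp add: shift_0)

section \<open>Derivations\<close>

lemma commutator_comp:
  "commutator c (a o\<^sub>L b) = (commutator c a o\<^sub>L b) + (a o\<^sub>L commutator c b)"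
  by (simp add: commutator_def op_comp.diff_left op_comp.diff_right op_comp_assoc)

lemma commutator_add_left: "commutator (c + d) a = commutator c a + commutator d a"
  by (simp add: commutator_def op_comp.add_left op_comp.add_right)

lemma commutator_diff_left: "commutator (c - d) a = commutator c a - commutator d a"
  by (simp add: commutator_def op_comp.diff_left op_comp.diff_right)

lemma commutator_add: "commutator c (a + b) = commutator c a + commutator c b"
  by (simp add: commutator_def op_comp.add_left op_comp.add_right)

lemma commutator_scaleC:
  "c \<in> bounded_ops \<Longrightarrow> commutator c (r *\<^sub>C a) = r *\<^sub>C commutator c a"
  by (simp add: commutator_def scaleC_comp_left scaleC_comp_right complex_space.scale_right_diff_distrib)

lemma commutator_sum: "commutator c (sum f A) = (\<Sum>a\<in>A. commutator c (f a))"
  by (simp add: commutator_def op_comp.sum_left op_comp.sum_right sum_subtractf)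

text \<open>This turns commutators with shifts into coboundaries, on which averaging can
  act.\<close>

lemma commutator_shift: "commutator c (shift n) = (c - conj_V n c) o\<^sub>L shift n"
  by (simp add: commutator_def conj_V_def op_comp.diff_left op_comp_assoc shift_shift shift_0)

text \<open>The uniqueness part: a nonzero scalar is not a norm limit of coboundaries, since
  averaging fixes scalars, does not increase norms, and sends each coboundary to 0 as the length
  grows.\<close>

lemma commutator_V_tendsto_scalar_imp_0:
  assumes lim: "(\<lambda>n. commutator (b n) V) \<longlonglongrightarrow> c *\<^sub>C V"
  shows "c = 0"
proof -
  let ?c = "c *\<^sub>C (id_blinfun :: operator)"
  have "(\<lambda>n. commutator (b n) V o\<^sub>L V_inv) \<longlonglongrightarrow> ((c *\<^sub>C V) o\<^sub>L V_inv)"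
    by (intro op_comp.tendsto lim tendsto_const)
  then have lim': "(\<lambda>n. b n - conj_V 1 (b n)) \<longlonglongrightarrow> ?c"
    by (simp add: commutator_shift op_comp_assoc shift_shift shift_0 scaleC_comp_left)
  have avg: "average M ?c = ?c" if "0 < M" for M
  proof -
    have "conj_V k ?c = ?c" for k
      by (simp add: conj_V_def scaleC_comp_left scaleC_comp_right shift_in_bounded_ops shift_shift shift_0)
    then show ?thesis using that by (simp add: average_def sum_constant_scaleR)
  qed
  have "norm ?c \<le> e" if e: "0 < e" for e
  proof -
    obtain n where n: "norm (b n - conj_V 1 (b n) - ?c) < e"
      using LIMSEQ_D[OF lim' e] by blast
    \<comment> \<open>Here \<open>n\<close> is fixed and only the averaging length grows, so that
      the first summand disappears and \<open>e\<close> remains. The length \<open>Suc M\<close> is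
      never zero.\<close>
    have "norm ?c \<le> 2 * norm (b n) / real (Suc M) + e" for M
    proof -
      have "norm ?c \<le> norm (average (Suc M) (b n - conj_V 1 (b n)))
          + norm (average (Suc M) (b n - conj_V 1 (b n)) - average (Suc M) ?c)"
        using norm_triangle_sub[of ?c "average (Suc M) (b n - conj_V 1 (b n))"]
        by (simp add: avg norm_minus_commute)
      also have "\<dots> \<le> 2 * norm (b n) / real (Suc M) + norm (b n - conj_V 1 (b n) - ?c)"
        unfolding average_diff[symmetric]
        by (intro add_mono norm_average_coboundary_le norm_average_le)
      finally show ?thesis using n by linarith
    qed
    moreover have "(\<lambda>M. 2 * norm (b n) / real (Suc M) + e) \<longlonglongrightarrow> 0 + e"
      by (intro tendsto_add tendsto_const LIMSEQ_Suc[OF lim_const_over_n])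
    ultimately show ?thesis by (intro tendsto_lowerbound[of _ "0 + e" sequentially, simplified]) auto
  qed
  then have "norm ?c \<le> 0" by (rule field_le_epsilon[of _ 0, simplified])
  then have "?c = 0" by (simp only: norm_le_zero_iff)
  \<comment> \<open>Evaluation at a basis vector recovers the scalar from the operator.\<close>
  then have "?c (E 0) = 0" by (simp only: blinfun.zero_left)
  then have "coord (?c (E 0)) 0 = 0" by (simp add: coord_simps)
  then show ?thesis by (simp add: scaleC_blinfun.rep_eq coord_simps)
qed

section \<open>Derivations on the dense algebra\<close>

lemma alg_BD_in_BD: "a \<in> alg_BD N \<Longrightarrow> a \<in> BD N"
  by (simp add: alg_BD_eq poly_BD_in_BD)

lemma alg_BD_comp: "a \<in> alg_BD N \<Longrightarrow> b \<in> alg_BD N \<Longrightarrow> a o\<^sub>L b \<in> alg_BD N"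
  by (simp add: alg_BD_eq poly_BD_comp)

lemmas subspace_alg_BD = subspace_poly_BD[folded alg_BD_eq]
  and shift_in_alg_BD = shift_in_poly_BD[folded alg_BD_eq]
  and diag_op_in_alg_BD = diag_op_in_poly_BD[folded alg_BD_eq]
  and alg_BD_subset = poly_BD_subset[folded alg_BD_eq]
lemmas alg_BD_add = complex_space.subspace_add[OF subspace_alg_BD]
  and alg_BD_scaleC = complex_space.subspace_scale[OF subspace_alg_BD]
  and alg_BD_0 = complex_space.subspace_0[OF subspace_alg_BD]
  and alg_BD_sum = complex_space.subspace_sum[OF subspace_alg_BD]

context
  fixes N :: supernatural and \<delta> :: "operator \<Rightarrow> operator"
  assumes deriv: "derivation N \<delta>"
begin

lemma derivation_in_BD: "a \<in> alg_BD N \<Longrightarrow> \<delta> a \<in> BD N"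
  and derivation_add: "a \<in> alg_BD N \<Longrightarrow> b \<in> alg_BD N \<Longrightarrow> \<delta> (a + b) = \<delta> a + \<delta> b"
  and derivation_scaleC: "a \<in> alg_BD N \<Longrightarrow> \<delta> (c *\<^sub>C a) = c *\<^sub>C \<delta> a"
  and derivation_comp:
    "a \<in> alg_BD N \<Longrightarrow> b \<in> alg_BD N \<Longrightarrow> \<delta> (a o\<^sub>L b) = (\<delta> a o\<^sub>L b) + (a o\<^sub>L \<delta> b)"
  using deriv by (auto simp: derivation_def)

lemma derivation_0: "\<delta> 0 = 0"
  using derivation_scaleC[OF alg_BD_0, of 0] by simp

lemma derivation_sum:
  "(\<And>i. i \<in> I \<Longrightarrow> f i \<in> alg_BD N) \<Longrightarrow> \<delta> (sum f I) = (\<Sum>i\<in>I. \<delta> (f i))"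
  by (induction I rule: infinite_finite_induct)
    (simp_all add: derivation_0 derivation_add alg_BD_sum)

lemma derivation_id: "\<delta> id_blinfun = 0"
  using derivation_comp[of id_blinfun id_blinfun] shift_in_alg_BD[of 0 N] by (simp add: shift_0)

text \<open>Both the commutators and \<delta> obey the Leibniz rule, so the elements at which
  convergence holds are closed under products and linear combinations. It remains to reach the
  inverse shift and hence all monomials.\<close>

lemma approximately_innerI:
  assumes b: "\<And>n. b n \<in> BD N"
    and V: "(\<lambda>n. commutator (b n) V) \<longlonglongrightarrow> \<delta> V"
    and diag: "\<And>f. f \<in> coeffs_BD N \<Longrightarrow> (\<lambda>n. commutator (b n) (diag_op f)) \<longlonglongrightarrow> \<delta> (diag_op f)"
  shows "approximately_inner N \<delta>"
proof -
  define S where "S = {a \<in> alg_BD N. (\<lambda>n. commutator (b n) a) \<longlonglongrightarrow> \<delta> a}"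
  have comp: "a o\<^sub>L c \<in> S" if "a \<in> S" "c \<in> S" for a c
    using that unfolding S_def
    by (auto simp: alg_BD_comp derivation_comp commutator_comp
        intro!: tendsto_add op_comp.tendsto tendsto_const)
  have V_S: "V \<in> S" using V by (simp add: S_def shift_in_alg_BD)
  \<comment> \<open>Obtained by applying \<delta> to the product of \<open>V\<close> and
    \<open>V_inv\<close>, which is the identity.\<close>
  have "\<delta> V_inv = - (V_inv o\<^sub>L \<delta> V o\<^sub>L V_inv)"
  proof -
    have "V_inv o\<^sub>L ((\<delta> V o\<^sub>L V_inv) + (V o\<^sub>L \<delta> V_inv)) = 0"
      using derivation_comp[OF shift_in_alg_BD shift_in_alg_BD, of 1 "- 1"]
      by (simp add: V_V_inv derivation_id)
    then have "(V_inv o\<^sub>L \<delta> V o\<^sub>L V_inv) + \<delta> V_inv = 0"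
      by (simp add: op_comp.add_right op_comp_assoc[symmetric] V_V_inv)
    then show ?thesis by (simp add: eq_neg_iff_add_eq_0 add.commute)
  qed
  \<comment> \<open>The same formula holds for commutators, so convergence at \<open>V\<close>
    carries over to \<open>V_inv\<close>.\<close>
  moreover have "commutator (b n) V_inv = - (V_inv o\<^sub>L commutator (b n) V o\<^sub>L V_inv)" for n
    by (simp add: commutator_def op_comp.diff_left op_comp.diff_right op_comp_assoc V_V_inv)
      (simp add: op_comp_assoc[symmetric] V_V_inv)
  ultimately have V_inv_S: "V_inv \<in> S"
    unfolding S_def
    by (auto simp: shift_in_alg_BD intro!: tendsto_minus op_comp.tendsto tendsto_const V)
  have shift_S: "shift n \<in> S" for n
  proof (induction n rule: int_induct[where k = 0])
    case base
    show ?case using comp[OF V_S V_inv_S] by (simp add: shift_shift)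
  next
    case (step1 i)
    show ?case using comp[OF step1(2) V_S] by (simp add: shift_shift)
  next
    case (step2 i)
    show ?case using comp[OF step2(2) V_inv_S] by (simp add: shift_shift)
  qed
  have "alg_BD N \<subseteq> S"
  proof (rule alg_BD_subset)
    show "complex_space.subspace S"
      using alg_BD_0 unfolding complex_space.subspace_def S_def
      by (auto simp: derivation_0 derivation_add derivation_scaleC commutator_add
          commutator_scaleC[OF BD_bounded_ops[OF b]] alg_BD_add alg_BD_scaleC
          intro!: tendsto_add bounded_linear.tendsto[OF bounded_linear_scaleC])
        (simp add: commutator_def)
    show "shift n o\<^sub>L diag_op f \<in> S" if "f \<in> coeffs_BD N" for n f
      using diag[OF that] diag_op_in_alg_BD[OF that] by (intro comp shift_S) (simp add: S_def)
  qed
  then show ?thesis using b unfolding approximately_inner_def S_def by blast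
qed

end

section \<open>Residue projections and the commutant of periodic diagonal operators\<close>

definition residue_proj :: "nat \<Rightarrow> int \<Rightarrow> operator" where
  "residue_proj j k = diag_op (\<lambda>l. if l mod int j = k then 1 else 0)"

lemma residue_indicator_periodic: "(\<lambda>l. if l mod int j = k then 1 else 0) \<in> periodic j"
  by (simp add: periodic_def)

lemma coord_residue_proj:
  "coord (residue_proj j k x) l = (if l mod int j = k then coord x l else 0)"
proof -
  have "bounded (range (\<lambda>l. if l mod int j = k then 1 else (0 :: complex)))"
    by (rule finite_imp_bounded, rule finite_subset[of _ "{0, 1}"]) auto
  from coord_diag_op[OF this] show ?thesis by (simp add: residue_proj_def)
qed

lemma residue_proj_comp:
  "residue_proj j k o\<^sub>L residue_proj j m = (if k = m then residue_proj j m else 0)"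
  by (rule op_eqI) (simp add: coord_residue_proj coord_simps)

lemma diag_op_residue_expansion:
  assumes "b \<in> periodic j" "0 < j"
  shows "diag_op b = (\<Sum>k\<in>{0..<int j}. b k *\<^sub>C residue_proj j k)"
proof (rule op_eqI)
  fix x l
  have "coord ((\<Sum>k\<in>{0..<int j}. b k *\<^sub>C residue_proj j k) x) l
      = (\<Sum>k\<in>{0..<int j}. if l mod int j = k then b k * coord x l else 0)"
    by (simp add: blinfun.sum_left coord_sum scaleC_blinfun.rep_eq coord_simps coord_residue_proj
        if_distrib cong: if_cong sum.cong)
  also have "\<dots> = coord (diag_op b x) l"
    using assms by (simp add: sum.delta' coord_diag_op bounded_periodic periodic_mod)
  finally show "coord (diag_op b x) l = coord ((\<Sum>k\<in>{0..<int j}. b k *\<^sub>C residue_proj j k) x) l" ..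
qed

lemma sum_residue_proj: "0 < j \<Longrightarrow> (\<Sum>k\<in>{0..<int j}. residue_proj j k) = id_blinfun"
  using diag_op_residue_expansion[of "\<lambda>_. 1" j] by (simp add: periodic_def diag_op_1 scaleC_one)

text \<open>The element \<open>c_j\<close> of the overview. Derivations on a finite-dimensional
  commutative algebra spanned by orthogonal projections are implemented in this way, through the
  separability idempotent.\<close>

definition periodic_implementer :: "(operator \<Rightarrow> operator) \<Rightarrow> nat \<Rightarrow> operator" where
  "periodic_implementer \<delta> j = (\<Sum>k\<in>{0..<int j}. \<delta> (residue_proj j k) o\<^sub>L residue_proj j k)"

definition periodic_commutant :: "nat \<Rightarrow> operator set" where
  "periodic_commutant j = {T. \<forall>b\<in>periodic j. T o\<^sub>L diag_op b = diag_op b o\<^sub>L T}"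

lemma periodic_commutant_scaleR: "T \<in> periodic_commutant j \<Longrightarrow> r *\<^sub>R T \<in> periodic_commutant j"
  by (simp add: periodic_commutant_def op_comp.scaleR_left op_comp.scaleR_right)

lemma periodic_commutant_sum:
  "(\<And>i. i \<in> I \<Longrightarrow> f i \<in> periodic_commutant j) \<Longrightarrow> sum f I \<in> periodic_commutant j"
  by (simp add: periodic_commutant_def op_comp.sum_left op_comp.sum_right)

text \<open>Conjugation by a shift maps the \<open>j\<close>-periodic diagonal operators to
  themselves, hence preserves their commutant.\<close>

lemma periodic_commutant_conj_V:
  assumes "T \<in> periodic_commutant j" "0 < j"
  shows "conj_V k T \<in> periodic_commutant j"
  unfolding periodic_commutant_def
proof (intro CollectI ballI)
  fix b assume b: "b \<in> periodic j"
  let ?b = "\<lambda>l. b (l + k)"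
  have b': "?b \<in> periodic j" using b by (rule periodic_translate)
  have "diag_op b o\<^sub>L shift k = shift k o\<^sub>L diag_op ?b"
    using diag_op_shift[OF bounded_periodic[OF b assms(2)]] .
  moreover have "shift (- k) o\<^sub>L diag_op b = diag_op ?b o\<^sub>L shift (- k)"
    using diag_op_shift[OF bounded_periodic[OF b' assms(2)], of "- k"] by simp
  moreover have "T o\<^sub>L diag_op ?b = diag_op ?b o\<^sub>L T"
    using assms(1) b' by (simp add: periodic_commutant_def)
  ultimately show "conj_V k T o\<^sub>L diag_op b = diag_op b o\<^sub>L conj_V k T"
    unfolding conj_V_def by (metis op_comp_assoc)
qed

lemma average_in_periodic_commutant:
  "T \<in> periodic_commutant j \<Longrightarrow> 0 < j \<Longrightarrow> average M T \<in> periodic_commutant j"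
  unfolding average_def
  by (intro periodic_commutant_scaleR periodic_commutant_sum periodic_commutant_conj_V)

lemma corrector_in_periodic_commutant:
  "T \<in> periodic_commutant j \<Longrightarrow> 0 < j \<Longrightarrow> corrector M T \<in> periodic_commutant j"
  unfolding corrector_def
  by (intro periodic_commutant_scaleR periodic_commutant_sum periodic_commutant_conj_V)

lemma periodic_commutant_limit:
  assumes "\<And>k. X k \<in> periodic_commutant j" "X \<longlonglongrightarrow> T"
  shows "T \<in> periodic_commutant j"
  unfolding periodic_commutant_def
proof (intro CollectI ballI)
  fix b assume "b \<in> periodic j"
  then have "X k o\<^sub>L diag_op b = diag_op b o\<^sub>L X k" for k
    using assms(1) by (simp add: periodic_commutant_def)
  moreover have "(\<lambda>k. X k o\<^sub>L diag_op b) \<longlonglongrightarrow> (T o\<^sub>L diag_op b)"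
    "(\<lambda>k. diag_op b o\<^sub>L X k) \<longlonglongrightarrow> (diag_op b o\<^sub>L T)"
    by (intro op_comp.tendsto assms(2) tendsto_const)+
  ultimately show "T o\<^sub>L diag_op b = diag_op b o\<^sub>L T" using LIMSEQ_unique by simp
qed

text \<open>Commuting with residue projections modulo \<open>j\<close> kills the matrix entries
  between different residue classes. For distinct indices, infinitude of \<open>N\<close> supplies a
  \<open>j\<close> separating them, so \<open>T\<close> is diagonal; commuting with \<open>V\<close>
  makes the diagonal constant.\<close>

lemma scalar_if_commuting:
  assumes inf: "infinite_supernatural N" and bd: "T \<in> bounded_ops"
    and V: "conj_V 1 T = T" and per: "\<And>j. j dvd\<^sub>s N \<Longrightarrow> T \<in> periodic_commutant j"
  shows "\<exists>c. T = c *\<^sub>C id_blinfun"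
proof -
  have off: "coord (T (E l)) k = 0" if "k \<noteq> l" for k l
  proof -
    obtain j where j: "j dvd\<^sub>s N" "\<not> j dvd nat \<bar>k - l\<bar>"
      using infinite_supernatural_not_dvd[OF inf, of "nat \<bar>k - l\<bar>"] \<open>k \<noteq> l\<close> by auto
    have "\<not> int j dvd k - l" using j(2) by (simp add: dvd_nat_abs_iff)
    then have kl: "k mod int j \<noteq> l mod int j" by (simp add: mod_eq_dvd_iff)
    have E: "residue_proj j (l mod int j) (E l) = E l"
      by (rule ell2_eqI) (simp add: coord_residue_proj coord_simps)
    have comm: "T o\<^sub>L residue_proj j (l mod int j) = residue_proj j (l mod int j) o\<^sub>L T"
      using per[OF j(1)] residue_indicator_periodic
      by (simp add: periodic_commutant_def residue_proj_def)
    have "T (E l) = residue_proj j (l mod int j) (T (E l))"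
      using arg_cong[OF comm, of "\<lambda>A. A (E l)"] by (simp add: E)
    then have "coord (T (E l)) k = coord (residue_proj j (l mod int j) (T (E l))) k" by simp
    then show ?thesis using kl by (simp add: coord_residue_proj)
  qed
  have TV: "T o\<^sub>L V = V o\<^sub>L T"
  proof -
    have "conj_V 1 T o\<^sub>L V = V o\<^sub>L T"
      by (simp add: conj_V_def op_comp_assoc shift_shift shift_0)
    then show ?thesis by (simp add: V)
  qed
  have step: "coord (T (E (l + 1))) (l + 1) = coord (T (E l)) l" for l
    using arg_cong[OF TV, of "\<lambda>A. coord (A (E l)) (l + 1)"] by (simp add: V_E)
  define c where "c = coord (T (E 0)) 0"
  have diag: "coord (T (E l)) l = c" for l
  proof (induction l rule: int_induct[where k = 0])
    case (step2 i)
    then show ?case using step[of "i - 1"] by simp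
  qed (simp_all add: c_def step)
  have "T = c *\<^sub>C id_blinfun"
  proof (rule bounded_ops_eqI[OF bd])
    show "c *\<^sub>C id_blinfun \<in> bounded_ops"
      by (simp add: bounded_ops_iff scaleC_blinfun.rep_eq scaleC_scaleC mult.commute)
    show "T (E l) = (c *\<^sub>C id_blinfun) (E l)" for l
      using off diag by (intro ell2_eqI) (auto simp: scaleC_blinfun.rep_eq coord_simps)
  qed
  then show ?thesis ..
qed

section \<open>Implementing a derivation on periodic diagonal operators\<close>

context
  fixes N :: supernatural and \<delta> :: "operator \<Rightarrow> operator"
  assumes deriv: "derivation N \<delta>"
begin

lemma residue_proj_in_alg_BD: "j dvd\<^sub>s N \<Longrightarrow> residue_proj j k \<in> alg_BD N"
  unfolding residue_proj_def
  using residue_indicator_periodic by (intro diag_op_in_alg_BD) (auto simp: coeffs_BD_def)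

lemma periodic_implementer_in_BD: "j dvd\<^sub>s N \<Longrightarrow> periodic_implementer \<delta> j \<in> BD N"
  unfolding periodic_implementer_def
  by (intro BD_sum BD_comp derivation_in_BD[OF deriv] alg_BD_in_BD residue_proj_in_alg_BD)

text \<open>The projections span the \<open>j\<close>-periodic diagonal operators, so it suffices to
  compare both sides on each of them.\<close>

lemma commutator_periodic_implementer:
  assumes j: "j dvd\<^sub>s N" and b: "b \<in> periodic j"
  shows "commutator (periodic_implementer \<delta> j) (diag_op b) = \<delta> (diag_op b)"
proof -
  have pos: "0 < j" using j by (simp add: dvd_supernatural_def)
  define P where "P = residue_proj j"
  note P = residue_proj_in_alg_BD[OF j, folded P_def]
  note PP = residue_proj_comp[of j, folded P_def]
  let ?K = "{0..<int j}" and ?c = "periodic_implementer \<delta> j"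
  have proj: "commutator ?c (P m) = \<delta> (P m)" if m: "m \<in> ?K" for m
  proof -
    have left: "?c o\<^sub>L P m = \<delta> (P m) o\<^sub>L P m"
    proof -
      have "?c o\<^sub>L P m = (\<Sum>k\<in>?K. if k = m then \<delta> (P m) o\<^sub>L P m else 0)"
        unfolding periodic_implementer_def P_def[symmetric] op_comp.sum_left
        by (intro sum.cong) (auto simp: op_comp_assoc PP)
      then show ?thesis using m by (simp add: sum.delta)
    qed
    \<comment> \<open>The Leibniz rule for \<open>P m o\<^sub>L P k\<close>, multiplied by
      \<open>P k\<close> on the right. Summing the last term over \<open>k\<close> produces
      \<delta>\<open>(P m)\<close>, because the projections add up to the identity.\<close>
    have "P m o\<^sub>L (\<delta> (P k) o\<^sub>L P k) = (if k = m then \<delta> (P m) o\<^sub>L P m else 0) - (\<delta> (P m) o\<^sub>L P k)"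
      for k
    proof -
      have "P m o\<^sub>L \<delta> (P k) = \<delta> (P m o\<^sub>L P k) - (\<delta> (P m) o\<^sub>L P k)"
        using derivation_comp[OF deriv P P, of m k] by simp
      then have "P m o\<^sub>L (\<delta> (P k) o\<^sub>L P k) = (\<delta> (P m o\<^sub>L P k) o\<^sub>L P k) - ((\<delta> (P m) o\<^sub>L P k) o\<^sub>L P k)"
        by (simp add: op_comp_assoc[symmetric] op_comp.diff_left)
      then show ?thesis
        by (simp add: op_comp_assoc PP derivation_0[OF deriv])
    qed
    then have "P m o\<^sub>L ?c = (\<delta> (P m) o\<^sub>L P m) - (\<delta> (P m) o\<^sub>L (\<Sum>k\<in>?K. P k))"
      unfolding periodic_implementer_def P_def[symmetric] op_comp.sum_right
      using m by (simp add: sum_subtractf sum.delta)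
    then show ?thesis
      using sum_residue_proj[OF pos] left by (simp add: commutator_def P_def)
  qed
  have "?c \<in> bounded_ops" by (rule BD_bounded_ops[OF periodic_implementer_in_BD[OF j]])
  then have "commutator ?c (diag_op b) = (\<Sum>k\<in>?K. b k *\<^sub>C \<delta> (P k))"
    unfolding diag_op_residue_expansion[OF b pos] P_def[symmetric] commutator_sum
    by (intro sum.cong refl) (simp add: commutator_scaleC proj)
  also have "\<dots> = \<delta> (diag_op b)"
    unfolding diag_op_residue_expansion[OF b pos] P_def[symmetric]
    by (subst derivation_sum[OF deriv]) (auto simp: P alg_BD_scaleC derivation_scaleC[OF deriv])
  finally show ?thesis .
qed

section \<open>The remaining defect at the shift\<close>

definition defect :: "nat \<Rightarrow> operator" where
  "defect j = (\<delta> V - commutator (periodic_implementer \<delta> j) V) o\<^sub>L V_inv"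

text \<open>The dependence on \<open>j\<close> sits entirely in a coboundary, which the averages
  remove in the limit.\<close>

lemma defect_eq:
  "defect j = (\<delta> V o\<^sub>L V_inv) - (periodic_implementer \<delta> j - conj_V 1 (periodic_implementer \<delta> j))"
  by (simp add: defect_def commutator_shift op_comp.diff_left op_comp_assoc V_V_inv shift_shift shift_0)

lemma defect_in_BD: "j dvd\<^sub>s N \<Longrightarrow> defect j \<in> BD N"
  unfolding defect_eq
  by (intro BD_diff BD_comp derivation_in_BD[OF deriv] shift_in_alg_BD shift_in_BD
      periodic_implementer_in_BD conj_V_in_BD)

text \<open>Subtracting the commutator with \<open>c_j\<close> from \<delta> leaves a map obeying
  the Leibniz rule and vanishing on the \<open>j\<close>-periodic diagonal operators. Applying it to
  both sides of \<open>diag_op b o\<^sub>L V = V o\<^sub>L diag_op b'\<close> gives the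
  relation.\<close>

lemma defect_in_periodic_commutant:
  assumes j: "j dvd\<^sub>s N"
  shows "defect j \<in> periodic_commutant j"
  unfolding periodic_commutant_def
proof (intro CollectI ballI)
  have pos: "0 < j" using j by (simp add: dvd_supernatural_def)
  let ?c = "periodic_implementer \<delta> j"
  define D where "D = \<delta> V - commutator ?c V"
  fix b assume b: "b \<in> periodic j"
  define b' where "b' = (\<lambda>l. b (l + 1))"
  have b': "b' \<in> periodic j" unfolding b'_def using b by (rule periodic_translate)
  have alg: "diag_op f \<in> alg_BD N" if "f \<in> periodic j" for f
    using that j by (intro diag_op_in_alg_BD) (auto simp: coeffs_BD_def)
  have eq: "diag_op b o\<^sub>L V = V o\<^sub>L diag_op b'"
    unfolding b'_def by (rule diag_op_shift[OF bounded_periodic[OF b pos]])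
  have "\<delta> (diag_op b o\<^sub>L V) - commutator ?c (diag_op b o\<^sub>L V) = diag_op b o\<^sub>L D"
    using b by (simp add: derivation_comp[OF deriv] alg shift_in_alg_BD commutator_comp D_def
        commutator_periodic_implementer[OF j] op_comp.diff_right)
  moreover have "\<delta> (V o\<^sub>L diag_op b') - commutator ?c (V o\<^sub>L diag_op b') = D o\<^sub>L diag_op b'"
    using b' by (simp add: derivation_comp[OF deriv] alg shift_in_alg_BD commutator_comp D_def
        commutator_periodic_implementer[OF j] op_comp.diff_left)
  ultimately have D: "diag_op b o\<^sub>L D = D o\<^sub>L diag_op b'" by (simp add: eq)
  have "diag_op b' o\<^sub>L V_inv = V_inv o\<^sub>L diag_op b"
    using diag_op_shift[OF bounded_periodic[OF b' pos], of "- 1"] by (simp add: b'_def)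
  then show "defect j o\<^sub>L diag_op b = diag_op b o\<^sub>L defect j"
    unfolding defect_def D_def[symmetric] using D by (metis op_comp_assoc)
qed

lemma average_defect_tendsto:
  assumes inf: "infinite_supernatural N"
  obtains c where
    "\<And>j. j dvd\<^sub>s N \<Longrightarrow> (\<lambda>k. average (divisor_chain N k) (defect j)) \<longlonglongrightarrow> c *\<^sub>C id_blinfun"
proof -
  define S where "S = \<delta> V o\<^sub>L V_inv"
  let ?A = "\<lambda>k. average (divisor_chain N k)"
  have S: "S \<in> BD N"
    unfolding S_def by (intro BD_comp derivation_in_BD[OF deriv] shift_in_alg_BD shift_in_BD)
  obtain T where T: "(\<lambda>k. ?A k S) \<longlonglongrightarrow> T"
    using convergent_average[OF S] by (auto simp: convergent_def)
  \<comment> \<open>The limit \<open>T\<close> is the same for every \<open>j\<close>; this later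
    places \<open>T\<close> in all the periodic commutants at once.\<close>
  have defect: "(\<lambda>k. ?A k (defect j)) \<longlonglongrightarrow> T" for j
    using tendsto_diff[OF T average_coboundary_tendsto_0[OF inf]]
    by (simp add: defect_eq average_diff S_def)
  have T_BD: "T \<in> BD N"
    using closed_sequentially[OF closed_BD _ T] average_in_BD[OF S] by simp
  have "conj_V 1 T = T"
  proof (rule LIMSEQ_unique)
    show "(\<lambda>k. conj_V 1 (?A k S)) \<longlonglongrightarrow> conj_V 1 T"
      by (rule bounded_linear.tendsto[OF bounded_linear_conj_V T])
    \<comment> \<open>The change of an average under conjugation by \<open>V\<close> is the average
      of a coboundary and tends to 0.\<close>
    have "?A k (S - conj_V 1 S) = ?A k S - conj_V 1 (?A k S)" for k
      by (simp add: average_diff) (simp add: average_def conj_V_scaleR conj_V_sum conj_V_conj_V add.commute)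
    then show "(\<lambda>k. conj_V 1 (?A k S)) \<longlonglongrightarrow> T"
      using tendsto_diff[OF T average_coboundary_tendsto_0[OF inf, of S]] by simp
  qed
  moreover have "T \<in> periodic_commutant j" if j: "j dvd\<^sub>s N" for j
    by (rule periodic_commutant_limit[OF average_in_periodic_commutant[OF defect_in_periodic_commutant[OF j]] defect])
      (use j in \<open>simp add: dvd_supernatural_def\<close>)
  ultimately obtain c where "T = c *\<^sub>C id_blinfun"
    using scalar_if_commuting[OF inf BD_bounded_ops[OF T_BD]] by blast
  then show thesis using that defect by blast
qed

lemma derivation_L_commutator: "derivation N (\<lambda>a. \<delta> a - c *\<^sub>C L_commutator a)"
  unfolding derivation_def
proof (intro conjI ballI allI)
  note L = is_L_commutator_L_commutator
  show "\<delta> a - c *\<^sub>C L_commutator a \<in> BD N" if "a \<in> alg_BD N" for a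
    using that by (intro BD_diff derivation_in_BD[OF deriv] BD_scaleC alg_BD_in_BD L(2))
  show "\<delta> (a + b) - c *\<^sub>C L_commutator (a + b)
      = (\<delta> a - c *\<^sub>C L_commutator a) + (\<delta> b - c *\<^sub>C L_commutator b)"
    if "a \<in> alg_BD N" "b \<in> alg_BD N" for a b
    using L_commutator_eqI[OF is_L_commutator_add[OF L(1)[OF that(1)] L(1)[OF that(2)]]] that
    by (simp add: derivation_add[OF deriv] scaleC_add_right)
  show "\<delta> (r *\<^sub>C a) - c *\<^sub>C L_commutator (r *\<^sub>C a) = r *\<^sub>C (\<delta> a - c *\<^sub>C L_commutator a)"
    if "a \<in> alg_BD N" for r a
    using L_commutator_eqI[OF is_L_commutator_scaleC[OF L(1)[OF that]]] that
    by (simp add: derivation_scaleC[OF deriv] complex_space.scale_right_diff_distrib scaleC_scaleC mult.commute)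
  show "\<delta> (a o\<^sub>L b) - c *\<^sub>C L_commutator (a o\<^sub>L b)
      = ((\<delta> a - c *\<^sub>C L_commutator a) o\<^sub>L b) + (a o\<^sub>L (\<delta> b - c *\<^sub>C L_commutator b))"
    if ab: "a \<in> alg_BD N" "b \<in> alg_BD N" for a b
  proof -
    have bd: "a \<in> bounded_ops" "b \<in> bounded_ops"
      using ab by (auto intro: BD_bounded_ops alg_BD_in_BD)
    show ?thesis
      using L_commutator_eqI[OF is_L_commutator_comp[OF L(1)[OF ab(1)] L(1)[OF ab(2)] bd]] ab
      by (simp add: derivation_comp[OF deriv] scaleC_add_right op_comp.diff_left op_comp.diff_right
          scaleC_comp_left scaleC_comp_right bd)
  qed
qed

lemma approximately_inner_L_commutator:
  assumes inf: "infinite_supernatural N"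
  obtains c where "approximately_inner N (\<lambda>a. \<delta> a - c *\<^sub>C L_commutator a)"
proof -
  obtain c where c:
    "\<And>j. j dvd\<^sub>s N \<Longrightarrow> (\<lambda>k. average (divisor_chain N k) (defect j)) \<longlonglongrightarrow> c *\<^sub>C id_blinfun"
    using average_defect_tendsto[OF inf] by blast
  let ?J = "divisor_chain N"
  note J = divisor_chain_dvd_supernatural[of N]
  \<comment> \<open>For each \<open>n\<close> the averages of this single defect converge, so a
    length \<open>M\<close> with error below \<open>1 / (n + 1)\<close> can be picked separately for
    every \<open>n\<close>.\<close>
  have "\<exists>M>0. norm (average M (defect (?J n)) - c *\<^sub>C id_blinfun) < 1 / real (Suc n)" for n
    using LIMSEQ_D[OF c[OF J[of n]], of "1 / real (Suc n)"] divisor_chain_pos[of N] by fastforce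
  then obtain M where M: "\<And>n. 0 < M n"
    "\<And>n. norm (average (M n) (defect (?J n)) - c *\<^sub>C id_blinfun) < 1 / real (Suc n)"
    by metis
  define x where "x n = corrector (M n) (defect (?J n))" for n
  define b where "b n = periodic_implementer \<delta> (?J n) + x n" for n
  have "approximately_inner N (\<lambda>a. \<delta> a - c *\<^sub>C L_commutator a)"
  proof (rule approximately_innerI[OF derivation_L_commutator])
    show "b n \<in> BD N" for n
      unfolding b_def x_def
      by (intro BD_add periodic_implementer_in_BD corrector_in_BD defect_in_BD J)
    \<comment> \<open>Adding the corrector replaces the defect by its average, which is close to the
      scalar \<open>c\<close>.\<close>
    have "commutator (b n) V = \<delta> V - (average (M n) (defect (?J n)) o\<^sub>L V)" for n
    proof -
      have "commutator (x n) V = (defect (?J n) o\<^sub>L V) - (average (M n) (defect (?J n)) o\<^sub>L V)"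
        unfolding commutator_shift x_def corrector_coboundary[OF M(1)] op_comp.diff_left ..
      moreover have "defect (?J n) o\<^sub>L V = \<delta> V - commutator (periodic_implementer \<delta> (?J n)) V"
        by (simp add: defect_def op_comp_assoc V_V_inv)
      ultimately show ?thesis by (simp add: b_def commutator_add_left)
    qed
    moreover have "(\<lambda>n. average (M n) (defect (?J n))) \<longlonglongrightarrow> c *\<^sub>C id_blinfun"
    proof (rule LIM_zero_cancel, rule Lim_null_comparison)
      show "\<forall>\<^sub>F n in sequentially.
          norm (average (M n) (defect (?J n)) - c *\<^sub>C id_blinfun) \<le> 1 / real (Suc n)"
        using M(2) by (intro always_eventually allI less_imp_le)
      show "(\<lambda>n. 1 / real (Suc n)) \<longlonglongrightarrow> 0"
        by (rule LIMSEQ_Suc[OF lim_const_over_n])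
    qed
    then have "(\<lambda>n. \<delta> V - (average (M n) (defect (?J n)) o\<^sub>L V)) \<longlonglongrightarrow> \<delta> V - ((c *\<^sub>C id_blinfun) o\<^sub>L V)"
      by (intro tendsto_diff op_comp.tendsto tendsto_const)
    ultimately show "(\<lambda>n. commutator (b n) V) \<longlonglongrightarrow> \<delta> V - c *\<^sub>C L_commutator V"
      by (simp add: scaleC_comp_left L_commutator_V)
    fix f assume f: "f \<in> coeffs_BD N"
    then obtain j where j: "j dvd\<^sub>s N" "f \<in> periodic j" by (auto simp: coeffs_BD_def)
    \<comment> \<open>The corrector commutes with the periodic diagonal operators at stage
      \<open>n\<close>, so the agreement achieved by the implementer survives. Convergence on
      diagonal operators is thus eventual equality.\<close>
    have "commutator (b n) (diag_op f) = \<delta> (diag_op f)" if "j \<le> n" for n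
    proof -
      have f_n: "f \<in> periodic (?J n)" by (rule periodic_dvd[OF j(2) dvd_divisor_chain[OF j(1) that]])
      have "x n \<in> periodic_commutant (?J n)"
        unfolding x_def
        by (intro corrector_in_periodic_commutant defect_in_periodic_commutant J divisor_chain_pos)
      then have "commutator (x n) (diag_op f) = 0"
        using f_n by (simp add: commutator_def periodic_commutant_def)
      then show ?thesis
        using commutator_periodic_implementer[OF J f_n] by (simp add: b_def commutator_add_left)
    qed
    then have "\<forall>\<^sub>F n in sequentially. \<delta> (diag_op f) = commutator (b n) (diag_op f)"
      unfolding eventually_sequentially by (intro exI[of _ j]) simp
    then show "(\<lambda>n. commutator (b n) (diag_op f)) \<longlonglongrightarrow> \<delta> (diag_op f) - c *\<^sub>C L_commutator (diag_op f)"
      using Lim_transform_eventually[OF tendsto_const] by (simp add: L_commutator_diag_op[OF f])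
  qed
  then show thesis by (rule that)
qed

end

section \<open>Existence and uniqueness of the constant\<close>

theorem theorem4p4:
  fixes N :: supernatural and \<delta> :: "operator \<Rightarrow> operator"
  assumes "infinite_supernatural N"
    and "derivation N \<delta>"
  shows "\<exists>!C::complex. \<exists>\<delta>'. derivation N \<delta>' \<and> approximately_inner N \<delta>' \<and>
           (\<forall>b\<in>alg_BD N. \<delta> b = C *\<^sub>C L_commutator b + \<delta>' b)"
proof (rule ex_ex1I)
  obtain c where "approximately_inner N (\<lambda>a. \<delta> a - c *\<^sub>C L_commutator a)"
    using approximately_inner_L_commutator[OF assms(2,1)] .
  then show "\<exists>C \<delta>'. derivation N \<delta>' \<and> approximately_inner N \<delta>' \<and>
      (\<forall>b\<in>alg_BD N. \<delta> b = C *\<^sub>C L_commutator b + \<delta>' b)"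
    using derivation_L_commutator[OF assms(2), of c]
    by (intro exI[of _ c] exI[of _ "\<lambda>a. \<delta> a - c *\<^sub>C L_commutator a"]) simp
next
  fix C1 C2
  assume "\<exists>\<delta>'. derivation N \<delta>' \<and> approximately_inner N \<delta>' \<and>
      (\<forall>b\<in>alg_BD N. \<delta> b = C1 *\<^sub>C L_commutator b + \<delta>' b)"
    "\<exists>\<delta>'. derivation N \<delta>' \<and> approximately_inner N \<delta>' \<and>
      (\<forall>b\<in>alg_BD N. \<delta> b = C2 *\<^sub>C L_commutator b + \<delta>' b)"
  \<comment> \<open>Evaluation at \<open>V\<close> suffices for comparing the constants, because the
    number operator satisfies \<open>[L, V] = V\<close>.\<close>
  then obtain \<delta>1 \<delta>2 where "approximately_inner N \<delta>1" "approximately_inner N \<delta>2"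
    and V: "\<delta> V = C1 *\<^sub>C V + \<delta>1 V" "\<delta> V = C2 *\<^sub>C V + \<delta>2 V"
    using shift_in_alg_BD[of 1 N] by (metis L_commutator_V)
  then obtain b1 b2 where "(\<lambda>n. commutator (b1 n) V) \<longlonglongrightarrow> \<delta>1 V" "(\<lambda>n. commutator (b2 n) V) \<longlonglongrightarrow> \<delta>2 V"
    using shift_in_alg_BD[of 1 N] unfolding approximately_inner_def by blast
  \<comment> \<open>The differences of the two approximating sequences have commutators with
    \<open>V\<close> converging to \<open>(C1 - C2) V\<close>, so the scalar lemma applies.\<close>
  then have "(\<lambda>n. commutator (b2 n - b1 n) V) \<longlonglongrightarrow> \<delta>2 V - \<delta>1 V"
    by (simp add: commutator_diff_left tendsto_diff)
  moreover have "\<delta>2 V - \<delta>1 V = (C1 - C2) *\<^sub>C V"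
    using V by (simp add: complex_space.scale_left_diff_distrib algebra_simps)
  ultimately have "C1 - C2 = 0" by (intro commutator_V_tendsto_scalar_imp_0) simp
  then show "C1 = C2" by simp
qed

end
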